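(* Let $1\le d<d_Z$, $p\ge1$, $m\ge1$ be integers, let $G_\theta:\mathbb{R}^d\times\mathbb{R}^{d_Z-d}\to\mathbb{R}^p$ and $\mathcal{F}:\mathbb{R}^p\to\mathbb{R}^m$ be maps, and define $H(u,z_{\mathrm{rec}}):=\mathcal{F}(G_\theta(u,z_{\mathrm{rec}}))\in\mathbb{R}^m$. Assume $H$ is continuously differentiable at a reference point $(u_0,z_0)$ and let $$A_u:=\left.\frac{\partial H}{\partial u}\right|_{(u_0,z_0)}\in\mathbb{R}^{m\times d},\qquad A_{\mathrm{rec}}:=\left.\frac{\partial H}{\partial z_{\mathrm{rec}}}\right|_{(u_0,z_0)}\in\mathbb{R}^{m\times(d_Z-d)}.$$ Consider the linearized observation model $$y=H(u_0,z_0)+A_u(u-u_0)+A_{\mathrm{rec}}(z_{\mathrm{rec}}-z_0)+\varepsilon,\qquad \varepsilon\sim\mathcal{N}(0,\Sigma_\varepsilon),\quad \Sigma_\varepsilon\succ0,$$ with $\varepsilon$ independent of $(u,z_{\mathrm{rec}})$, and with independent Gaussian priors $u\sim\mathcal{N}(m_u,\Sigma_u)$, $\Sigma_u\succ0$, and $z_{\mathrm{rec}}\sim\mathcal{N}(0,I_{d_Z-d})$. Then: 1. (Unique posterior mean/MAP.) For every $y\in\mathbb{R}^m$, the negative log-posterior of the linearized model is a strictly convex quadratic function of $(u,z_{\mathrm{rec}})$, hence has a unique minimizer; equivalently, the linearized Gaussian posterior has a unique mean, which coincides with the MAP. 2. (Decoupling condition.) If $A_u^\top\Sigma_\varepsilon^{-1}A_{\mathrm{rec}}=0$,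 then the Gaussian posterior of the linearized model factorizes as $p(u,z_{\mathrm{rec}}\mid y)=p(u\mid y)\,p(z_{\mathrm{rec}}\mid y)$, i.e. the posterior covariance is block diagonal between $u$ and $z_{\mathrm{rec}}$. 3. (Noiseless local injectivity.) If the combined Jacobian $A:=[A_u\;A_{\mathrm{rec}}]\in\mathbb{R}^{m\times d_Z}$ has full column rank, then the linearized map $$(u,z_{\mathrm{rec}})\mapsto H(u_0,z_0)+A_u(u-u_0)+A_{\mathrm{rec}}(z_{\mathrm{rec}}-z_0)$$ is injective; equivalently, in the noiseless linearized model ($\varepsilon=0$), $(u,z_{\mathrm{rec}})$ is uniquely determined by $y$.
   Context: $M\succ0$ means $M$ is symmetric positive definite. The posterior is the conditional density of $(u,z_{\mathrm{rec}})$ given $y$ under the stated model, i.e. proportional to the Gaussian likelihood of $y$ times the prior density; the MAP is a maximizer of this density. The negative log-posterior is taken up to additive constants independent of $(u,z_{\mathrm{rec}})$. *)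

theory Defs
  imports "HOL-Probability.Probability"
begin

text \<open>Pairs \<open>(u, z)\<close> live in \<open>real^'d \<times> real^'r\<close>, where \<open>'r\<close> indexes the
  \<open>d_Z - d\<close> remaining latent coordinates; the stacked vector of dimension
  \<open>d_Z\<close> is indexed by the sum type \<open>'d + 'r\<close>.\<close>

definition stack :: "(real^'d) \<times> (real^'r) \<Rightarrow> real^('d + 'r)" where
  "stack x = (\<chi> k. case k of Inl i \<Rightarrow> fst x $ i | Inr j \<Rightarrow> snd x $ j)"

definition hcat :: "real^'d^'m \<Rightarrow> real^'r^'m \<Rightarrow> real^('d + 'r)^'m" where
  "hcat A B = (\<chi> i k. case k of Inl j \<Rightarrow> A $ i $ j | Inr j \<Rightarrow> B $ i $ j)"

definition block_diagonal :: "real^('d::finite + 'r::finite)^('d + 'r) \<Rightarrow> bool" where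
  "block_diagonal C \<longleftrightarrow> (\<forall>i j. C $ Inl i $ Inr j = 0 \<and> C $ Inr j $ Inl i = 0)"

definition spd :: "real^'n^'n \<Rightarrow> bool" where
  "spd A \<longleftrightarrow> transpose A = A \<and> (\<forall>x. x \<noteq> 0 \<longrightarrow> 0 < x \<bullet> (A *v x))"

text \<open>Differentiable on a neighbourhood of the point, with derivative continuous at the point.\<close>

definition continuously_differentiable_at ::
    "('a::real_normed_vector \<Rightarrow> 'b::real_normed_vector) \<Rightarrow> 'a \<Rightarrow> bool" where
  "continuously_differentiable_at f x \<longleftrightarrow>
     (\<exists>S D. open S \<and> x \<in> S \<and>
        (\<forall>y\<in>S. (f has_derivative blinfun_apply (D y)) (at y)) \<and> isCont D x)"

definition strictly_convex :: "('a::real_vector \<Rightarrow> real) \<Rightarrow> bool" where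
  "strictly_convex f \<longleftrightarrow>
     (\<forall>x y t. x \<noteq> y \<and> 0 < t \<and> t < 1 \<longrightarrow>
        f ((1 - t) *\<^sub>R x + t *\<^sub>R y) < (1 - t) * f x + t * f y)"

definition quadratic :: "((real^'d) \<times> (real^'r) \<Rightarrow> real) \<Rightarrow> bool" where
  "quadratic f \<longleftrightarrow>
     (\<exists>Q b c. transpose Q = Q \<and>
        (\<forall>x. f x = (1/2) * (stack x \<bullet> (Q *v stack x)) + b \<bullet> stack x + c))"

text \<open>The density of \<open>\<N>(\<mu>, \<Sigma>)\<close>; meaningful for \<open>spd \<Sigma>\<close>.\<close>

definition gaussian_density :: "real^'n \<Rightarrow> real^'n^'n \<Rightarrow> real^'n \<Rightarrow> real" where
  "gaussian_density \<mu> \<Sigma> x =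
     exp (- (1/2) * ((x - \<mu>) \<bullet> (matrix_inv \<Sigma> *v (x - \<mu>)))) /
     sqrt ((2 * pi) ^ CARD('n) * det \<Sigma>)"

text \<open>The library's \<open>indep_var\<close> forces both variables to have the same codomain type.\<close>

definition independent_rvs ::
    "'w measure \<Rightarrow> ('w \<Rightarrow> 'x::topological_space) \<Rightarrow> ('w \<Rightarrow> 'y::topological_space) \<Rightarrow> bool" where
  "independent_rvs M X Y \<longleftrightarrow>
     X \<in> borel_measurable M \<and> Y \<in> borel_measurable M \<and>
     prob_space.indep_set M {X -` A \<inter> space M | A. A \<in> sets borel}
                            {Y -` B \<inter> space M | B. B \<in> sets borel}"

definition bayes_posterior ::
    "('y \<Rightarrow> 'x \<Rightarrow> real) \<Rightarrow> ('x \<Rightarrow> real) \<Rightarrow> 'y \<Rightarrow> 'x::euclidean_space \<Rightarrow> real" where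
  "bayes_posterior lik prior y x =
     lik y x * prior x / (\<integral>x'. lik y x' * prior x' \<partial>lborel)"

text \<open>\<open>k y\<close> is a probability density for every \<open>y\<close>, and the joint density of \<open>(X, Y)\<close> is the
  density of \<open>Y\<close> times \<open>k\<close>.  This determines \<open>k\<close> only up to null sets; \<open>bayes_posterior\<close>
  singles out the version that is defined for every \<open>y\<close>.\<close>

definition conditional_density ::
    "'w measure \<Rightarrow> ('w \<Rightarrow> 'x::euclidean_space) \<Rightarrow> ('w \<Rightarrow> 'y::euclidean_space) \<Rightarrow>
     ('y \<Rightarrow> 'x \<Rightarrow> real) \<Rightarrow> bool" where
  "conditional_density M X Y k \<longleftrightarrow>
     (\<forall>y x. 0 \<le> k y x) \<and>
     (\<forall>y. has_bochner_integral lborel (k y) 1) \<and>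
     (\<exists>g. distributed M lborel Y g \<and>
          distributed M lborel (\<lambda>\<omega>. (X \<omega>, Y \<omega>)) (\<lambda>(x, y). g y * ennreal (k y x)))"

text \<open>\<open>J\<close> is the negative logarithm of the density \<open>f\<close>, up to an additive constant.\<close>

definition neg_log_density :: "('x \<Rightarrow> real) \<Rightarrow> ('x \<Rightarrow> real) \<Rightarrow> bool" where
  "neg_log_density f J \<longleftrightarrow> (\<forall>x. 0 < f x) \<and> (\<exists>c. \<forall>x. J x = - ln (f x) + c)"

text \<open>Mean and covariance of a probability density; both include the existence of the integrals.\<close>

definition has_mean :: "('x::euclidean_space \<Rightarrow> real) \<Rightarrow> 'x \<Rightarrow> bool" where
  "has_mean f \<mu> \<longleftrightarrow> has_bochner_integral lborel (\<lambda>x. f x *\<^sub>R x) \<mu>"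

definition has_covariance ::
    "((real^'d) \<times> (real^'r) \<Rightarrow> real) \<Rightarrow> real^('d + 'r)^('d + 'r) \<Rightarrow> bool" where
  "has_covariance f C \<longleftrightarrow>
     (\<exists>\<mu>. has_mean f \<mu> \<and>
        (\<forall>k l. has_bochner_integral lborel
           (\<lambda>x. f x * ((stack x - stack \<mu>) $ k * (stack x - stack \<mu>) $ l)) (C $ k $ l)))"

end

theory Submission
  imports Defs
begin

text \<open>Likelihood times prior is the exponential of a quadratic form in the stacked variable
  whose Hessian \<open>A\<^sup>T \<Sigma>\<^sub>\<epsilon>\<^sup>-\<^sup>1 A + diag(\<Sigma>\<^sub>u\<^sup>-\<^sup>1, I)\<close> is positive definite: the data term is positive
  semidefinite and the prior term definite. Completing the square shows that the posterior is the
  Gaussian density with this precision matrix, which settles mean, covariance, MAP and convexity at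
  once; under the decoupling condition the off-diagonal block of the precision vanishes.
  The normalisation and moments of a multivariate Gaussian come from the factorisation
  \<open>\<Sigma> = B B\<^sup>T\<close> and the substitution \<open>x = \<mu> + B w\<close>.\<close>

subsection \<open>Linear change of variables\<close>

text \<open>Two settings have to be matched: the posterior is a density on pairs, whereas matrices
  and Gaussian densities live on \<open>real^('d + 'r)\<close>. The map \<open>stack\<close> carries
  one orthonormal basis onto the other, so it is an isometry preserving Lebesgue measure, and
  Gaussian integrals pass to pairs without a Jacobian factor. No normalising integral is evaluated
  for the posterior by itself: likelihood times prior equals a positive constant \<open>k y\<close>
  times a Gaussian density of total mass 1, so \<open>k y\<close> is the evidence and cancels in
  Bayes' formula. This gives the posterior at every single \<open>y\<close>, while a conditional
  density is determined only up to null sets; that the formula is a version of it is shown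
  separately, from the joint law of parameters and data. Injectivity involves no probability: the
  linearised map is affine with linear part \<open>hcat A_u A_rec\<close>, and full column rank
  makes that part injective.\<close>

lemma bij_betw_Basis_inner:
  fixes T :: "'a::euclidean_space \<Rightarrow> 'b::euclidean_space"
  assumes "linear T" and bij: "bij_betw T Basis Basis"
  shows "T x \<bullet> T y = x \<bullet> y"
proof -
  interpret linear T by fact
  have T: "T x = (\<Sum>b\<in>Basis. (x \<bullet> b) *\<^sub>R T b)" for x
    by (metis (no_types, lifting) euclidean_representation scale sum sum.cong)
  have "T b \<bullet> T c = b \<bullet> c" if "b \<in> Basis" "c \<in> Basis" for b c
    using that bij_betwE[OF bij] bij_betw_imp_inj_on[OF bij] by (auto simp: inner_Basis inj_on_eq_iff)
  then have "(\<Sum>b\<in>Basis. (x \<bullet> b) *\<^sub>R T b) \<bullet> (\<Sum>c\<in>Basis. (y \<bullet> c) *\<^sub>R T c)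
    = (\<Sum>b\<in>Basis. (x \<bullet> b) * (\<Sum>c\<in>Basis. (y \<bullet> c) * (b \<bullet> c)))"
    by (simp add: inner_sum_left inner_sum_right sum_distrib_left mult_ac cong: sum.cong)
       (subst sum.swap, simp add: mult_ac)
  also have "\<dots> = (\<Sum>b\<in>Basis. (x \<bullet> b) * (y \<bullet> b))"
    by (intro sum.cong refl arg_cong2[where f="(*)"])
       (simp add: inner_Basis if_distrib[where f="\<lambda>t. _ * t"] cong: if_cong)
  finally show ?thesis
    by (simp only: T[of x] T[of y] euclidean_inner[of x y])
qed

text \<open>Lebesgue measure is determined by the volumes of boxes, and such a map only relabels the
  sides of a box. It serves both the column swaps below and the map \<open>stack\<close>.\<close>

lemma lborel_distr_bij_Basis:
  fixes T :: "'a::euclidean_space \<Rightarrow> 'b::euclidean_space"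
  assumes T: "linear T" and bij: "bij_betw T Basis Basis"
  shows "distr lborel borel T = lborel"
proof (rule lborel_eqI[symmetric])
  have [measurable]: "T \<in> borel \<rightarrow>\<^sub>M borel"
    using T by (intro borel_measurable_continuous_onI linear_continuous_on linear_conv_bounded_linear[THEN iffD1])
  interpret linear T by fact
  fix l u :: 'b assume le: "\<And>b. b \<in> Basis \<Longrightarrow> l \<bullet> b \<le> u \<bullet> b"
  \<comment> \<open>\<open>S\<close> is the adjoint of \<open>T\<close>. As \<open>T\<close> is an
    isometry, \<open>S\<close> is also its inverse, so the preimage of a box has the corners
    \<open>S l\<close> and \<open>S u\<close>.\<close>
  define S where "S x = (\<Sum>b\<in>Basis. (x \<bullet> T b) *\<^sub>R b)" for x
  have S: "S x \<bullet> b = x \<bullet> T b" if "b \<in> Basis" for x b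
    using that by (simp add: S_def)
  have Basis_eq: "(Basis :: 'b set) = T ` Basis"
    using bij by (simp add: bij_betw_def)
  have "T -` box l u = box (S l) (S u)"
    by (simp add: box_def set_eq_iff Basis_eq S bij_betw_Basis_inner[OF T bij])
  moreover have "emeasure lborel (box (S l) (S u)) = (\<Prod>b\<in>Basis. (S u - S l) \<bullet> b)"
    using le by (subst emeasure_lborel_box) (auto simp: S Basis_eq)
  moreover have "(\<Prod>b\<in>Basis. (S u - S l) \<bullet> b) = (\<Prod>b\<in>Basis. (u - l) \<bullet> b)"
    using bij unfolding bij_betw_def Basis_eq
    by (subst prod.reindex) (auto simp: S inner_diff_left intro!: prod.cong)
  ultimately show "emeasure (distr lborel borel T) (box l u) = (\<Prod>b\<in>Basis. (u - l) \<bullet> b)"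
    by (simp add: emeasure_distr)
qed simp

lemma measurable_vec_lambda_PiM [measurable]:
  "(\<lambda>f. \<chi> i::'n::finite. f i) \<in> (\<Pi>\<^sub>M i\<in>UNIV. lborel) \<rightarrow>\<^sub>M (borel :: (real^'n) measure)"
proof (subst borel_measurable_euclidean_space, rule ballI)
  fix b :: "real^'n" assume "b \<in> Basis"
  then obtain i where "b = axis i 1"
    by (auto simp: Basis_vec_def)
  then show "(\<lambda>f. (\<chi> i. f i) \<bullet> b) \<in> (\<Pi>\<^sub>M i\<in>UNIV. lborel) \<rightarrow>\<^sub>M borel"
    by (simp add: inner_axis)
qed

lemma prod_Basis_vec:
  "(\<Prod>b\<in>Basis. g b) = (\<Prod>i\<in>UNIV. g (axis i 1 :: real^'n))"
proof -
  have "(Basis :: (real^'n) set) = (\<lambda>i. axis i 1) ` UNIV"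
    by (auto simp: Basis_vec_def)
  then show ?thesis
    by (metis (no_types, lifting) axis_eq_axis injI prod.reindex_cong zero_neq_one)
qed

text \<open>Makes iterated integration over single coordinates available on \<open>real^'n\<close>:
  for shears and for product integrands.\<close>

lemma lborel_vec_eq_PiM:
  "(lborel :: (real^'n) measure) = distr (\<Pi>\<^sub>M i\<in>UNIV. lborel) borel (\<lambda>f. \<chi> i. f i)"
proof (rule lborel_eqI)
  interpret product_sigma_finite "\<lambda>_::'n. lborel :: real measure" ..
  fix l u :: "real^'n" assume le: "\<And>b. b \<in> Basis \<Longrightarrow> l \<bullet> b \<le> u \<bullet> b"
  have le': "l $ i \<le> u $ i" for i
    using le[of "axis i 1"] by (simp add: inner_axis)
  have "(\<lambda>f. \<chi> i. f i) -` box l u \<inter> space (\<Pi>\<^sub>M i\<in>UNIV. lborel) = (\<Pi>\<^sub>E i\<in>UNIV. {l$i<..<u$i})"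
    by (auto simp: mem_box_cart space_PiM PiE_def Pi_def)
  then have "emeasure (distr (\<Pi>\<^sub>M i\<in>UNIV. lborel) borel (\<lambda>f. \<chi> i. f i)) (box l u)
    = (\<Prod>i\<in>UNIV. emeasure lborel {l$i<..<u$i})"
    by (subst emeasure_distr) (simp_all add: emeasure_PiM)
  also have "\<dots> = (\<Prod>i\<in>UNIV. ennreal (u$i - l$i))"
    using le' by simp
  also have "\<dots> = ennreal (\<Prod>b\<in>Basis. (u - l) \<bullet> b)"
    using le' by (simp add: prod_Basis_vec inner_axis prod_ennreal)
  finally show "emeasure (distr (\<Pi>\<^sub>M i\<in>UNIV. lborel) borel (\<lambda>f. \<chi> i. f i)) (box l u)
    = ennreal (\<Prod>b\<in>Basis. (u - l) \<bullet> b)" .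
qed simp

lemma borel_measurable_matrix_vector_mult [measurable (raw)]:
  fixes A :: "real^'n^'m"
  assumes "f \<in> borel_measurable M"
  shows "(\<lambda>x. A *v f x) \<in> borel_measurable M"
  using assms
  by (rule borel_measurable_continuous_on[OF matrix_vector_mult_linear_continuous_on])

text \<open>Integrate over coordinate \<open>m\<close> innermost. With the other coordinates fixed,
  the shear is a translation by \<open>c * x n\<close>, which does not depend on coordinate
  \<open>m\<close> because \<open>m \<noteq> n\<close>, and the one-dimensional integral is
  translation invariant.\<close>

lemma nn_integral_lborel_shear:
  fixes f :: "real^'n \<Rightarrow> ennreal"
  assumes [measurable]: "f \<in> borel_measurable borel" and mn: "m \<noteq> n"
  shows "(\<integral>\<^sup>+x. f (\<chi> i. if i = m then x$m + c * x$n else x$i) \<partial>lborel) = (\<integral>\<^sup>+x. f x \<partial>lborel)"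
proof -
  let ?P = "\<lambda>I. \<Pi>\<^sub>M i\<in>I. (lborel :: real measure)"
  interpret product_sigma_finite "\<lambda>_::'n. lborel :: real measure" ..
  let ?I = "UNIV - {m}"
  have U: "insert m ?I = UNIV" by auto
  have int: "integral\<^sup>N (?P UNIV) g = (\<integral>\<^sup>+x. \<integral>\<^sup>+y. g (x(m := y)) \<partial>lborel \<partial>?P ?I)"
    if "g \<in> borel_measurable (?P UNIV)" for g
    using product_nn_integral_insert[of ?I m g] that by (simp add: U)
  let ?S = "\<lambda>x :: real^'n. \<chi> i. if i = m then x$m + c * x$n else x$i"
  \<comment> \<open>The matrix form is wanted here only for measurability.\<close>
  have "?S = (*v) (\<chi> i j. if i = m \<and> j = n then c else of_bool (i = j))"
    using mn by (auto simp: fun_eq_iff vec_eq_iff matrix_vector_mult_def of_bool_def if_distrib[where f="\<lambda>t. t * _"]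
        sum.remove[where x=n] cong: if_cong)
  then have [measurable]: "?S \<in> borel_measurable borel"
    by simp
  have "(\<integral>\<^sup>+x. f (?S x) \<partial>lborel) = (\<integral>\<^sup>+x. f (\<chi> i. if i = m then x m + c * x n else x i) \<partial>?P UNIV)"
    by (subst lborel_vec_eq_PiM, subst nn_integral_distr) (simp_all cong: if_cong)
  also have "\<dots> = (\<integral>\<^sup>+x. \<integral>\<^sup>+y. f (\<chi> i. if i = m then y + c * x n else x i) \<partial>lborel \<partial>?P ?I)"
  proof (subst int)
    have "(\<lambda>x. f (?S (\<chi> i. x i))) \<in> borel_measurable (?P UNIV)"
      by measurable
    also have "(\<lambda>x. f (?S (\<chi> i. x i))) = (\<lambda>x. f (\<chi> i. if i = m then x m + c * x n else x i))"
      by (intro ext arg_cong[where f=f]) (simp add: vec_eq_iff)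
    finally show "(\<lambda>x. f (\<chi> i. if i = m then x m + c * x n else x i)) \<in> borel_measurable (?P UNIV)" .
    show "(\<integral>\<^sup>+x. \<integral>\<^sup>+y. f (\<chi> i. if i = m then (x(m := y)) m + c * (x(m := y)) n else (x(m := y)) i) \<partial>lborel \<partial>?P ?I) =
      (\<integral>\<^sup>+x. \<integral>\<^sup>+y. f (\<chi> i. if i = m then y + c * x n else x i) \<partial>lborel \<partial>?P ?I)"
      using mn by (intro nn_integral_cong arg_cong[where f=f]) (auto simp: vec_eq_iff)
  qed
  also have "\<dots> = (\<integral>\<^sup>+x. \<integral>\<^sup>+y. f (\<chi> i. if i = m then y else x i) \<partial>lborel \<partial>?P ?I)"
  proof (rule nn_integral_cong)
    fix x :: "'n \<Rightarrow> real"
    have "(\<lambda>y::real. f (\<chi> i. (x(m := y)) i)) \<in> borel_measurable borel"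
    proof (rule measurable_compose[OF _ assms(1)])
      have "(\<lambda>y. \<chi> i. (x(m := y)) i) = (\<lambda>y. (\<chi> i. if i = m then 0 else x i) + y *\<^sub>R axis m 1)"
        by (auto simp: fun_eq_iff vec_eq_iff axis_def)
      then show "(\<lambda>y::real. \<chi> i. (x(m := y)) i) \<in> borel_measurable borel"
        by simp
    qed
    then have *: "(\<lambda>y::real. f (\<chi> i. if i = m then y else x i)) \<in> borel_measurable borel"
      by (simp add: fun_upd_def)
    show "(\<integral>\<^sup>+y. f (\<chi> i. if i = m then y + c * x n else x i) \<partial>lborel) =
      (\<integral>\<^sup>+y. f (\<chi> i. if i = m then y else x i) \<partial>lborel)"
      using nn_integral_real_affine[OF *, of 1 "c * x n"] by (simp only: mult_1 abs_one ennreal_1 add.commute[of "c * x n"])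
  qed
  also have "\<dots> = (\<integral>\<^sup>+x. f (\<chi> i. x i) \<partial>?P UNIV)"
    by (subst int) (auto simp: fun_upd_def)
  also have "\<dots> = (\<integral>\<^sup>+x. f x \<partial>lborel)"
    by (subst lborel_vec_eq_PiM, subst nn_integral_distr) simp_all
  finally show ?thesis .
qed

text \<open>The library's linear change of variables in \<open>Change_Of_Vars\<close> needs a well-ordered index type,
  which \<open>'d + 'r\<close> is not; this version works for every finite index type.\<close>

lemma nn_integral_lborel_matrix:
  fixes B :: "real^'n^'n"
  assumes "f \<in> borel_measurable borel" and "det B \<noteq> 0"
  shows "(\<integral>\<^sup>+x. f x \<partial>lborel) = \<bar>det B\<bar> * (\<integral>\<^sup>+x. f (B *v x) \<partial>lborel)"
proof -
  \<comment> \<open>Quantifying over all \<open>f\<close> lets the product case apply the claim for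
    \<open>B\<close> to \<open>f\<close> composed with \<open>A\<close>; the guard on the
    determinant makes the case of a zero row vacuous.\<close>
  define P where "P B \<longleftrightarrow> det B \<noteq> 0 \<longrightarrow> (\<forall>f\<in>borel_measurable borel.
    (\<integral>\<^sup>+x. f x \<partial>lborel) = ennreal \<bar>det B\<bar> * (\<integral>\<^sup>+x. f (B *v x) \<partial>lborel))" for B :: "real^'n^'n"
  have "P B"
  proof (rule induct_matrix_elementary)
    fix A B assume A: "P A" and B: "P B"
    show "P (A ** B)"
      unfolding P_def
    proof (intro impI ballI)
      fix f :: "real^'n \<Rightarrow> ennreal"
      assume "det (A ** B) \<noteq> 0" and [measurable]: "f \<in> borel_measurable borel"
      then have nz: "det A \<noteq> 0" "det B \<noteq> 0"
        by (auto simp: det_mul)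
      have "(\<integral>\<^sup>+x. f x \<partial>lborel) = ennreal \<bar>det A\<bar> * (\<integral>\<^sup>+x. f (A *v x) \<partial>lborel)"
        using A nz \<open>f \<in> _\<close> unfolding P_def by blast
      also have "(\<integral>\<^sup>+x. f (A *v x) \<partial>lborel) = ennreal \<bar>det B\<bar> * (\<integral>\<^sup>+x. f (A *v (B *v x)) \<partial>lborel)"
        using B[unfolded P_def, rule_format, OF nz(2), of "\<lambda>x. f (A *v x)"] by simp
      finally show "(\<integral>\<^sup>+x. f x \<partial>lborel) = ennreal \<bar>det (A ** B)\<bar> * (\<integral>\<^sup>+x. f ((A ** B) *v x) \<partial>lborel)"
        by (simp add: det_mul abs_mult ennreal_mult mult.assoc matrix_vector_mul_assoc)
    qed
  next
    fix A :: "real^'n^'n" and i assume "row i A = 0"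
    then show "P A"
      unfolding P_def using det_zero_row(2) by blast
  next
    fix A :: "real^'n^'n" assume A: "\<And>i j. i \<noteq> j \<Longrightarrow> A$i$j = 0"
    show "P A"
      unfolding P_def
    proof (intro impI ballI)
      fix f :: "real^'n \<Rightarrow> ennreal"
      assume "det A \<noteq> 0" and [measurable]: "f \<in> borel_measurable borel"
      then have nz: "A$i$i \<noteq> 0" for i
        by (simp add: det_diagonal[OF A])
      \<comment> \<open>The diagonal entries, indexed by basis vectors instead of indices, as
        \<open>lborel_affine_euclidean\<close> expects its scaling factors. The \<open>0 +\<close>
        below is its translation part.\<close>
      define c where "c b = b \<bullet> (A *v b)" for b
      have c: "c (axis i 1) = A$i$i" for i
        by (simp add: c_def inner_axis' matrix_vector_mult_basis column_def)
      have Av: "0 + (\<Sum>j\<in>Basis. (c j * (x \<bullet> j)) *\<^sub>R j) = A *v x" for x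
      proof -
        have "(\<Sum>j\<in>Basis. (c j * (x \<bullet> j)) *\<^sub>R j) $ i = A$i$i * x$i" for i
        proof -
          have "(\<Sum>j\<in>Basis. (c j * (x \<bullet> j)) *\<^sub>R j) $ i = (\<Sum>j\<in>Basis. (c j * (x \<bullet> j)) *\<^sub>R j) \<bullet> axis i 1"
            by (simp add: inner_axis)
          also have "\<dots> = c (axis i 1) * (x \<bullet> axis i 1)"
            by (rule inner_sum_left_Basis) (auto simp: Basis_vec_def)
          finally show ?thesis
            by (simp add: c inner_axis)
        qed
        moreover have "(A *v x) $ i = A$i$i * x$i" for i
          using A by (simp add: matrix_vector_mult_def sum.remove[where x=i])
        ultimately show ?thesis
          by (simp add: vec_eq_iff)
      qed
      have "c j \<noteq> 0" if "j \<in> Basis" for j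
        using that nz by (auto simp: Basis_vec_def c)
      then have "lborel = density (distr lborel borel ((*v) A)) (\<lambda>_. (\<Prod>j\<in>Basis. \<bar>c j\<bar>))"
        using lborel_affine_euclidean[of c 0] unfolding Av by blast
      also have "(\<Prod>j\<in>Basis. \<bar>c j\<bar>) = \<bar>det A\<bar>"
        by (simp add: prod_Basis_vec c det_diagonal[OF A] abs_prod)
      finally have "integral\<^sup>N lborel f = integral\<^sup>N (density (distr lborel borel ((*v) A)) (\<lambda>_. \<bar>det A\<bar>)) f"
        by simp
      then show "(\<integral>\<^sup>+x. f x \<partial>lborel) = ennreal \<bar>det A\<bar> * (\<integral>\<^sup>+x. f (A *v x) \<partial>lborel)"
        by (simp add: nn_integral_density nn_integral_distr nn_integral_cmult)
    qed
  next
    fix m n :: 'n assume "m \<noteq> n"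
    let ?A = "(\<chi> i j. mat 1 $ i $ Transposition.transpose m n j) :: real^'n^'n"
    have col: "?A *v axis j 1 = axis (Transposition.transpose m n j) 1" for j
      unfolding matrix_vector_mult_basis by (auto simp: column_def vec_eq_iff mat_def axis_def)
    \<comment> \<open>The swap matrix permutes the basis vectors and is its own inverse.\<close>
    have "bij_betw ((*v) ?A) Basis Basis"
    proof (rule bij_betw_byWitness[where f'="(*v) ?A"])
    qed (auto simp: Basis_vec_def col)
    then have "distr lborel borel ((*v) ?A) = lborel"
      by (intro lborel_distr_bij_Basis) simp
    then have "integral\<^sup>N lborel f = (\<integral>\<^sup>+x. f (?A *v x) \<partial>lborel)" if "f \<in> borel_measurable borel" for f
      using that by (subst (1) \<open>distr lborel borel ((*v) ?A) = lborel\<close>[symmetric], subst nn_integral_distr) simp_all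
    moreover have "\<bar>det ?A\<bar> = 1"
      using det_permute_columns[OF permutes_swap_id[of m UNIV n], of "mat 1 :: real^'n^'n"] \<open>m \<noteq> n\<close>
      by (simp add: sign_swap_id abs_mult)
    ultimately show "P ?A"
      unfolding P_def by (simp only: ennreal_1 mult_1 simp_thms) blast
  next
    fix m n :: 'n and c :: real assume mn: "m \<noteq> n"
    let ?A = "(\<chi> i j. if i = m \<and> j = n then c else of_bool (i = j)) :: real^'n^'n"
    have Av: "?A *v x = (\<chi> i. if i = m then x$m + c * x$n else x$i)" for x
      using mn by (auto simp: vec_eq_iff matrix_vector_mult_def of_bool_def if_distrib[where f="\<lambda>t. t * _"]
        sum.remove[where x=n] cong: if_cong)
    have "det ?A = 1"
    proof -
      \<comment> \<open>The matrix arises from the identity by one row operation, which leaves the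
        determinant at 1.\<close>
      have "?A = (\<chi> k. if k = m then row m (mat 1) + c *s row n (mat 1) else row k (mat 1))"
        using mn by (auto simp: vec_eq_iff row_def mat_def)
      then show ?thesis
        using det_row_operation[OF mn, of "mat 1 :: real^'n^'n" c] by simp
    qed
    moreover have "(\<integral>\<^sup>+x. f (?A *v x) \<partial>lborel) = integral\<^sup>N lborel f" if "f \<in> borel_measurable borel" for f
      unfolding Av by (rule nn_integral_lborel_shear[OF that mn])
    ultimately show "P ?A"
      unfolding P_def by (intro impI ballI) (simp only: abs_one ennreal_1 mult_1)
  qed
  then show ?thesis
    using assms unfolding P_def by blast
qed

text \<open>As an identity of measures, the substitution rule also reaches signed and vector-valued
  integrands, which the moments require.\<close>

lemma lborel_distr_matrix_affine:
  fixes B :: "real^'n^'n"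
  assumes "det B \<noteq> 0"
  shows "lborel = density (distr lborel borel (\<lambda>x. t + B *v x)) (\<lambda>_. ennreal \<bar>det B\<bar>)"
proof (rule measure_eqI)
  fix S assume S: "S \<in> sets (lborel :: (real^'n) measure)"
  then have [measurable]: "S \<in> sets borel" by simp
  have "emeasure lborel S = (\<integral>\<^sup>+x. indicator S x \<partial>distr lborel borel ((+) t))"
    by (subst lborel_distr_plus) simp
  also have "\<dots> = (\<integral>\<^sup>+x. indicator S (t + x) \<partial>lborel)"
    by (subst nn_integral_distr) simp_all
  also have "\<dots> = \<bar>det B\<bar> * (\<integral>\<^sup>+x. indicator S (t + B *v x) \<partial>lborel)"
    by (rule nn_integral_lborel_matrix[OF _ assms]) measurable
  also have "\<dots> = emeasure (density (distr lborel borel (\<lambda>x. t + B *v x)) (\<lambda>_. ennreal \<bar>det B\<bar>)) S"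
    by (subst emeasure_density) (simp_all add: nn_integral_cmult nn_integral_distr del: nn_integral_indicator)
  finally show "emeasure lborel S = emeasure (density (distr lborel borel (\<lambda>x. t + B *v x)) (\<lambda>_. ennreal \<bar>det B\<bar>)) S" .
qed simp

subsection \<open>Moments of the multivariate Gaussian\<close>

lemma matrix_inv_eqI:
  fixes A :: "real^'n^'n"
  assumes "A ** B = mat 1"
  shows "matrix_inv A = B"
proof -
  have BA: "B ** A = mat 1"
    using assms by (simp add: matrix_left_right_inverse)
  have "A ** matrix_inv A = mat 1 \<and> matrix_inv A ** A = mat 1"
    unfolding matrix_inv_def by (rule someI[where x=B]) (simp add: assms BA)
  then show ?thesis
    by (metis BA matrix_mul_assoc matrix_mul_lid matrix_mul_rid)
qed

lemma spd_inner_commute: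
  assumes "spd Q"
  shows "x \<bullet> (Q *v y) = (Q *v x) \<bullet> y"
  using assms by (metis dot_lmul_matrix spd_def transpose_matrix_vector)

lemma spd_invertible:
  assumes "spd Q"
  shows "Q ** matrix_inv Q = mat 1" "matrix_inv Q ** Q = mat 1"
proof -
  have "x = 0" if "Q *v x = 0" for x
    using assms that by (force simp: spd_def)
  then obtain B where "B ** Q = mat 1"
    using matrix_left_invertible_ker[of Q] by blast
  then have "Q ** B = mat 1"
    by (simp add: matrix_left_right_inverse)
  then show "Q ** matrix_inv Q = mat 1" "matrix_inv Q ** Q = mat 1"
    using matrix_inv_eqI \<open>B ** Q = mat 1\<close> by metis+
qed

lemma spd_matrix_inv:
  assumes Q: "spd Q"
  shows "spd (matrix_inv Q)" "matrix_inv (matrix_inv Q) = Q"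
proof -
  let ?R = "matrix_inv Q"
  show "matrix_inv ?R = Q"
    by (rule matrix_inv_eqI) (rule spd_invertible(2)[OF Q])
  have "Q ** transpose ?R = mat 1"
    using Q spd_invertible(2)[OF Q] by (metis matrix_transpose_mul spd_def transpose_mat)
  then have "transpose ?R = ?R"
    by (metis matrix_inv_eqI)
  moreover have "0 < x \<bullet> (?R *v x)" if "x \<noteq> 0" for x
  proof -
    have x: "Q *v (?R *v x) = x"
      by (simp add: matrix_vector_mul_assoc spd_invertible[OF Q])
    then have "?R *v x \<noteq> 0"
      using that by force
    then have "0 < (?R *v x) \<bullet> (Q *v (?R *v x))"
      using Q by (simp add: spd_def)
    then show ?thesis
      by (simp add: x inner_commute)
  qed
  ultimately show "spd ?R"
    by (simp add: spd_def)
qed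

lemma spd_mat_1: "spd (mat 1 :: real^'n^'n)"
  by (simp add: spd_def)

text \<open>Gram-Schmidt for the inner product given by \<open>Q\<close>. Fewer vectors
  \<open>Q *v b i\<close> than the dimension leave a nonzero \<open>v\<close> orthogonal to all of
  them; this \<open>v\<close> is orthogonal to every \<open>b i\<close> with respect to
  \<open>Q\<close>, and dividing it by the square root of its \<open>Q\<close>-form gives the next
  member.\<close>

lemma spd_orthonormal_family:
  fixes Q :: "real^'n^'n" and S :: "'n set"
  assumes Q: "spd Q"
  shows "\<exists>b. \<forall>i\<in>S. \<forall>j\<in>S. b i \<bullet> (Q *v b j) = (if i = j then 1 else 0)"
proof -
  have "finite S" by simp
  then show ?thesis
  proof (induction S rule: finite_induct)
    case (insert k S)
    then obtain b where b: "\<And>i j. i \<in> S \<Longrightarrow> j \<in> S \<Longrightarrow> b i \<bullet> (Q *v b j) = (if i = j then 1 else 0)"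
      by blast
    have "dim ((\<lambda>i. Q *v b i) ` S) \<le> card S"
      by (meson card_image_le dim_le_card' finite_imageI insert.hyps(1) le_trans)
    also have "card S < card (UNIV :: 'n set)"
      using insert.hyps by (intro psubset_card_mono) auto
    finally have "dim ((\<lambda>i. Q *v b i) ` S) < DIM(real^'n)"
      by simp
    then obtain v where v: "v \<noteq> 0" "\<And>y. y \<in> span ((\<lambda>i. Q *v b i) ` S) \<Longrightarrow> orthogonal v y"
      using orthogonal_to_subspace_exists by blast
    have vb: "v \<bullet> (Q *v b i) = 0" if "i \<in> S" for i
      using v(2)[of "Q *v b i"] that by (simp add: span_base orthogonal_def)
    then have bv: "b i \<bullet> (Q *v v) = 0" if "i \<in> S" for i
      using that spd_inner_commute[OF Q, of "b i" v] by (simp add: inner_commute)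
    define q where "q = v \<bullet> (Q *v v)"
    have q: "q > 0"
      using v Q by (simp add: spd_def q_def)
    define b' where "b' = b(k := v /\<^sub>R sqrt q)"
    have "(v /\<^sub>R sqrt q) \<bullet> (Q *v (v /\<^sub>R sqrt q)) = 1"
      using q by (simp add: matrix_vector_mult_scaleR q_def[symmetric] field_simps)
    then have "\<forall>i\<in>insert k S. \<forall>j\<in>insert k S. b' i \<bullet> (Q *v b' j) = (if i = j then 1 else 0)"
      using insert.hyps(2) b vb bv by (auto simp: b'_def matrix_vector_mult_scaleR)
    then show ?case by blast
  qed simp
qed

text \<open>Take as columns of \<open>B\<close> a basis that is orthonormal for the inverse of
  \<open>C\<close>. The second and third facts handle exponent and normalisation under the
  substitution by \<open>B\<close>; the first one identifies the covariance.\<close>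

lemma spd_factor:
  fixes C :: "real^'n^'n"
  assumes C: "spd C"
  obtains B where "B ** transpose B = C" "transpose B ** matrix_inv C ** B = mat 1"
    "det C = (det B)\<^sup>2" "det B \<noteq> 0"
proof -
  let ?Q = "matrix_inv C"
  obtain b :: "'n \<Rightarrow> real^'n" where b: "\<And>i j. b i \<bullet> (?Q *v b j) = (if i = j then 1 else 0)"
    using spd_orthonormal_family[OF spd_matrix_inv(1)[OF C], of UNIV] by auto
  define B where "B = (\<chi> i j. b j $ i)"
  have B1: "B *v axis j 1 = b j" for j
    by (simp add: matrix_vector_mult_basis column_def B_def vec_eq_iff)
  have BQB: "transpose B ** ?Q ** B = mat 1"
  proof -
    have "(transpose B ** ?Q ** B) $ i $ j = axis i 1 \<bullet> ((transpose B ** ?Q ** B) *v axis j 1)" for i j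
      by (simp add: inner_axis' matrix_vector_mult_basis column_def)
    also have "\<dots> i j = (B *v axis i 1) \<bullet> (?Q *v (B *v axis j 1))" for i j
      by (metis dot_lmul_matrix matrix_vector_mul_assoc transpose_matrix_vector transpose_transpose)
    finally show ?thesis
      by (simp add: B1 b vec_eq_iff mat_def)
  qed
  \<comment> \<open>For square matrices a left inverse is a right inverse; multiplying by
    \<open>C\<close> on the right then removes \<open>?Q\<close>.\<close>
  then have "B ** (transpose B ** ?Q) = mat 1"
    by (simp add: matrix_left_right_inverse)
  then have "B ** transpose B ** (?Q ** C) = C"
    by (metis matrix_mul_assoc matrix_mul_lid)
  then have BB: "B ** transpose B = C"
    by (simp add: spd_invertible[OF C])
  moreover have "det C = (det B)\<^sup>2"
    by (simp add: BB[symmetric] det_mul power2_eq_square)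
  moreover have "det B \<noteq> 0"
    using arg_cong[OF BQB, of det] by (auto simp: det_mul)
  ultimately show thesis
    using BQB by (intro that)
qed

lemma spd_det_pos:
  assumes "spd C"
  shows "0 < det C"
  using spd_factor[OF assms] by (metis zero_less_power2)

section \<open>Standard Gaussian moments and their transfer to a general Gaussian\<close>

lemma has_bochner_integral_lborel_prod_vec:
  fixes f :: "'n::finite \<Rightarrow> real \<Rightarrow> real"
  assumes f: "\<And>i. has_bochner_integral lborel (f i) (v i)"
  shows "has_bochner_integral lborel (\<lambda>x::real^'n. \<Prod>i\<in>UNIV. f i (x $ i)) (\<Prod>i\<in>UNIV. v i)"
proof -
  interpret product_sigma_finite "\<lambda>_::'n. lborel :: real measure" ..
  have int: "integrable lborel (f i)" "integral\<^sup>L lborel (f i) = v i" for i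
    using f by (simp_all add: has_bochner_integral_iff)
  have [measurable]: "f i \<in> borel_measurable borel" for i
    using int(1)[of i] by (simp add: borel_measurable_integrable)
  have "has_bochner_integral (\<Pi>\<^sub>M i\<in>UNIV. lborel) (\<lambda>x. \<Prod>i\<in>UNIV. f i (x i)) (\<Prod>i\<in>UNIV. v i)"
    using product_integrable_prod[of UNIV f] product_integral_prod[of UNIV f] int
    by (simp add: has_bochner_integral_iff)
  then show ?thesis
    by (subst lborel_vec_eq_PiM, intro has_bochner_integral_distr) simp_all
qed

definition std_gauss :: "real^'n \<Rightarrow> real" where
  "std_gauss x = (\<Prod>i\<in>UNIV. std_normal_density (x $ i))"

lemma std_gauss_measurable [measurable]: "std_gauss \<in> borel_measurable borel"
  unfolding std_gauss_def by measurable

lemma std_gauss_eq: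
  "std_gauss (x :: real^'n) = exp (- (1/2) * (x \<bullet> x)) / sqrt ((2 * pi) ^ CARD('n))"
proof -
  have "std_gauss x = (\<Prod>i\<in>UNIV. exp (- (x $ i * x $ i / 2)) / sqrt (2 * pi))"
    by (simp add: std_gauss_def std_normal_density_def power2_eq_square)
  also have "\<dots> = exp (- (\<Sum>i\<in>UNIV. x $ i * x $ i / 2)) / sqrt (2 * pi) ^ CARD('n)"
    unfolding prod_dividef by (simp add: exp_sum sum_negf[symmetric])
  finally show ?thesis
    by (simp add: inner_vec_def real_sqrt_power[symmetric] sum_divide_distrib)
qed

text \<open>All three integrands are the density times a monomial with exponents at most 2, so each
  integral is a product of one-dimensional moments.\<close>

lemma std_gauss_moments:
  shows std_gauss_total: "has_bochner_integral lborel (std_gauss :: real^'n \<Rightarrow> real) 1"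
    and std_gauss_first: "has_bochner_integral lborel (\<lambda>x::real^'n. std_gauss x * x $ k) 0"
    and std_gauss_second: "has_bochner_integral lborel (\<lambda>x::real^'n. std_gauss x * (x $ k * x $ l))
           (if k = l then 1 else 0)"
proof -
  \<comment> \<open>The standard normal moments of orders 0, 1 and 2 are 1, 0 and 1.\<close>
  define e :: "nat \<Rightarrow> real" where "e = (\<lambda>p. if p = 1 then 0 else 1)"
  have mom: "has_bochner_integral lborel (\<lambda>t. std_normal_density t * t ^ p) (e p)" if "p < 3" for p
    using std_normal_moment_even[of 0] std_normal_moment_odd[of 0] std_normal_moment_even[of 1] that
    by (auto simp: e_def less_Suc_eq numeral_3_eq_3 numeral_2_eq_2)
  have gen: "has_bochner_integral lborel (\<lambda>x::real^'n. std_gauss x * g x) c"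
    if "\<And>i. p i < 3" and "\<And>x. (\<Prod>i\<in>UNIV. x $ i ^ p i) = g x" and "(\<Prod>i\<in>UNIV. e (p i)) = c" for p g c
    using has_bochner_integral_lborel_prod_vec[of "\<lambda>i t. std_normal_density t * t ^ p i" "\<lambda>i. e (p i)"] mom that
    by (simp add: std_gauss_def prod.distrib)
  have single: "(\<Prod>i\<in>UNIV. h i) = h k" if "\<And>i. i \<noteq> k \<Longrightarrow> h i = 1" for h :: "'n \<Rightarrow> real" and k
    using that by (simp add: prod.remove[where x=k])
  show "has_bochner_integral lborel (std_gauss :: real^'n \<Rightarrow> real) 1"
    using gen[of "\<lambda>_. 0" "\<lambda>_. 1" 1] by (simp add: e_def)
  show "has_bochner_integral lborel (\<lambda>x::real^'n. std_gauss x * x $ k) 0"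
    by (rule gen[where p="\<lambda>i. if i = k then 1 else 0"]; (subst single[of k])?) (simp_all add: e_def)
  show "has_bochner_integral lborel (\<lambda>x::real^'n. std_gauss x * (x $ k * x $ l)) (if k = l then 1 else 0)"
  proof (cases "k = l")
    case True
    have "has_bochner_integral lborel (\<lambda>x::real^'n. std_gauss x * (x $ k * x $ k)) 1"
      by (rule gen[where p="\<lambda>i. if i = k then 2 else 0"]; (subst single[of k])?) (simp_all add: e_def power2_eq_square)
    then show ?thesis
      using True by simp
  next
    case False
    have "has_bochner_integral lborel (\<lambda>x::real^'n. std_gauss x * (x $ k * x $ l)) 0"
    proof (rule gen[where p="\<lambda>i. if i = k \<or> i = l then 1 else 0"])
      show "(\<Prod>i\<in>UNIV. x $ i ^ (if i = k \<or> i = l then 1 else 0)) = x $ k * x $ l" for x :: "real^'n"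
        using False by (subst prod.remove[where x=k], simp, simp, subst prod.remove[where x=l]) auto
      show "(\<Prod>i\<in>UNIV. e (if i = k \<or> i = l then 1 else 0)) = 0"
        by (rule prod_zero[OF _ bexI[of _ k]]) (auto simp: e_def)
    qed simp
    then show ?thesis
      using False by simp
  qed
qed

text \<open>Under the substitution by \<open>B\<close> the exponent becomes
  \<open>x \<bullet> x\<close>, and the Jacobian factor, the absolute value of \<open>det B\<close>,
  equals the square root of \<open>det C\<close> and cancels it. Only integrals against
  \<open>std_gauss\<close> remain.\<close>

lemma has_bochner_integral_gaussian_density:
  fixes f :: "real^'n \<Rightarrow> 'b::{banach, second_countable_topology}"
  assumes C: "spd C" and BB: "transpose B ** matrix_inv C ** B = mat 1"
    and det: "det C = (det B)\<^sup>2" "det B \<noteq> 0"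
    and [measurable]: "f \<in> borel_measurable borel"
    and f: "has_bochner_integral lborel (\<lambda>x. std_gauss x *\<^sub>R f (\<mu> + B *v x)) v"
  shows "has_bochner_integral lborel (\<lambda>x. gaussian_density \<mu> C x *\<^sub>R f x) v"
proof -
  have gm [measurable]: "gaussian_density \<mu> C \<in> borel_measurable borel"
    unfolding gaussian_density_def by measurable
  have "(B *v x) \<bullet> (matrix_inv C *v (B *v x)) = x \<bullet> x" for x
  proof -
    have "(B *v x) \<bullet> (matrix_inv C *v (B *v x)) = x \<bullet> ((transpose B ** matrix_inv C ** B) *v x)"
      by (metis dot_lmul_matrix matrix_vector_mul_assoc transpose_matrix_vector transpose_transpose)
    then show ?thesis by (simp add: BB)
  qed
  then have g: "\<bar>det B\<bar> * gaussian_density \<mu> C (\<mu> + B *v x) = std_gauss x" for x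
    using det by (simp add: gaussian_density_def std_gauss_eq real_sqrt_mult)
  show ?thesis
  proof (subst lborel_distr_matrix_affine[OF det(2), of \<mu>], rule has_bochner_integral_density)
    have "has_bochner_integral lborel
      (\<lambda>x. \<bar>det B\<bar> *\<^sub>R (gaussian_density \<mu> C (\<mu> + B *v x) *\<^sub>R f (\<mu> + B *v x))) v"
      using f by (simp add: g scaleR_scaleR)
    then show "has_bochner_integral (distr lborel borel (\<lambda>x. \<mu> + B *v x))
      (\<lambda>x. \<bar>det B\<bar> *\<^sub>R (gaussian_density \<mu> C x *\<^sub>R f x)) v"
      by (intro has_bochner_integral_distr) simp_all
  qed simp_all
qed

lemma gaussian_density_total:
  fixes \<mu> :: "real^'n"
  assumes C: "spd C"
  shows "has_bochner_integral lborel (gaussian_density \<mu> C) 1"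
proof -
  obtain B where B: "transpose B ** matrix_inv C ** B = mat 1" "det C = (det B)\<^sup>2" "det B \<noteq> 0"
    using spd_factor[OF C] by metis
  show ?thesis
    using has_bochner_integral_gaussian_density[OF C B, of "\<lambda>_. 1::real" \<mu> 1] std_gauss_total by simp
qed

lemma gaussian_density_mean:
  fixes \<mu> :: "real^'n"
  assumes C: "spd C"
  shows "has_bochner_integral lborel (\<lambda>x. gaussian_density \<mu> C x *\<^sub>R x) \<mu>"
proof -
  obtain B where B: "transpose B ** matrix_inv C ** B = mat 1" "det C = (det B)\<^sup>2" "det B \<noteq> 0"
    using spd_factor[OF C] by metis
  \<comment> \<open>The vector-valued first moment is assembled from its coordinates; it is 0 and
    stays 0 under \<open>B\<close>, so only the shift by \<mu> contributes to the mean.\<close>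
  have "has_bochner_integral lborel (\<lambda>x. \<Sum>k\<in>UNIV. (std_gauss x * x $ k) *\<^sub>R axis k (1::real)) (\<Sum>k\<in>(UNIV::'n set). 0 *\<^sub>R axis k 1)"
    by (intro has_bochner_integral_sum has_bochner_integral_scaleR_left std_gauss_first)
  also have "(\<lambda>x::real^'n. \<Sum>k\<in>UNIV. (std_gauss x * x $ k) *\<^sub>R axis k (1::real)) = (\<lambda>x. std_gauss x *\<^sub>R x)"
    by (simp add: fun_eq_iff vec_eq_iff axis_def if_distrib cong: if_cong)
  finally have "has_bochner_integral lborel (\<lambda>x::real^'n. std_gauss x *\<^sub>R x) 0"
    by simp
  from has_bochner_integral_bounded_linear[OF matrix_vector_mul_bounded_linear[of B] this]
  have "has_bochner_integral lborel (\<lambda>x. std_gauss x *\<^sub>R (B *v x)) 0"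
    by (simp add: matrix_vector_mult_scaleR)
  with has_bochner_integral_scaleR_left[OF std_gauss_total, of \<mu>]
  have "has_bochner_integral lborel (\<lambda>x. std_gauss x *\<^sub>R (\<mu> + B *v x)) (1 *\<^sub>R \<mu> + 0)"
    unfolding scaleR_add_right by (intro has_bochner_integral_add) simp_all
  then show ?thesis
    using has_bochner_integral_gaussian_density[OF C B, of "\<lambda>x. x" \<mu> \<mu>] by simp
qed

lemma gaussian_density_covariance:
  fixes \<mu> :: "real^'n"
  assumes C: "spd C"
  shows "has_bochner_integral lborel (\<lambda>x. gaussian_density \<mu> C x * ((x - \<mu>) $ k * (x - \<mu>) $ l)) (C $ k $ l)"
proof -
  obtain B where BB: "B ** transpose B = C"
    and B: "transpose B ** matrix_inv C ** B = mat 1" "det C = (det B)\<^sup>2" "det B \<noteq> 0"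
    using spd_factor[OF C] by metis
  \<comment> \<open>Entries \<open>k\<close> and \<open>l\<close> of \<open>B *v x\<close> are
    multiplied out. The second moments keep only the terms with \<open>i = j\<close>, whose sum is
    an entry of \<open>B ** transpose B\<close>.\<close>
  have "has_bochner_integral lborel
      (\<lambda>x. \<Sum>i\<in>UNIV. \<Sum>j\<in>UNIV. B$k$i * B$l$j * (std_gauss x * (x $ i * x $ j)))
      (\<Sum>i\<in>UNIV. \<Sum>j\<in>UNIV. B$k$i * B$l$j * (if i = j then 1 else 0))"
    by (intro has_bochner_integral_sum has_bochner_integral_mult_right std_gauss_second)
  also have "(\<Sum>i\<in>UNIV. \<Sum>j\<in>UNIV. B$k$i * B$l$j * (if i = j then 1 else 0)) = C $ k $ l"
    by (simp add: BB[symmetric] matrix_matrix_mult_def transpose_def if_distrib cong: if_cong)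
  also have "(\<lambda>x. \<Sum>i\<in>UNIV. \<Sum>j\<in>UNIV. B$k$i * B$l$j * (std_gauss x * (x $ i * x $ j)))
    = (\<lambda>x. std_gauss x * ((B *v x) $ k * (B *v x) $ l))"
  proof
    fix x
    have "(B *v x) $ k * (B *v x) $ l = (\<Sum>i\<in>UNIV. \<Sum>j\<in>UNIV. (B$k$i * x$i) * (B$l$j * x$j))"
      by (simp only: matrix_vector_mult_def vec_lambda_beta sum_product)
    then show "(\<Sum>i\<in>UNIV. \<Sum>j\<in>UNIV. B$k$i * B$l$j * (std_gauss x * (x $ i * x $ j)))
      = std_gauss x * ((B *v x) $ k * (B *v x) $ l)"
      by (simp only: sum_distrib_left mult_ac)
  qed
  finally have "has_bochner_integral lborel
      (\<lambda>x. std_gauss x *\<^sub>R ((\<mu> + B *v x - \<mu>) $ k * (\<mu> + B *v x - \<mu>) $ l)) (C $ k $ l)"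
    by simp
  moreover have "(\<lambda>x. (x - \<mu>) $ k * (x - \<mu>) $ l) \<in> borel_measurable borel"
    by (intro borel_measurable_continuous_onI continuous_intros)
  ultimately have "has_bochner_integral lborel
      (\<lambda>x. gaussian_density \<mu> C x *\<^sub>R ((x - \<mu>) $ k * (x - \<mu>) $ l)) (C $ k $ l)"
    by (intro has_bochner_integral_gaussian_density[OF C B])
  then show ?thesis
    by simp
qed

subsection \<open>Gaussian densities on a product space\<close>

definition unstack :: "real^('d + 'r) \<Rightarrow> (real^'d) \<times> (real^'r)" where
  "unstack s = ((\<chi> i. s $ Inl i), (\<chi> j. s $ Inr j))"

lemma stack_unstack [simp]: "stack (unstack s) = s"
  by (simp add: stack_def unstack_def vec_eq_iff split: sum.split)

lemma unstack_stack [simp]: "unstack (stack x) = x"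
  by (simp add: stack_def unstack_def prod_eq_iff vec_eq_iff)

lemma stack_nth [simp]: "stack x $ Inl i = fst x $ i" "stack x $ Inr j = snd x $ j"
  by (simp_all add: stack_def)

lemma linear_stack: "linear (stack :: (real^'d) \<times> (real^'r) \<Rightarrow> _)"
  by (rule linearI) (auto simp: stack_def vec_eq_iff split: sum.split)

lemmas stack_add = linear_add[OF linear_stack]
  and stack_diff = linear_diff[OF linear_stack]
  and stack_scaleR = linear_cmul[OF linear_stack]
  and stack_0 [simp] = linear_0[OF linear_stack]

lemma linear_unstack: "linear (unstack :: _ \<Rightarrow> (real^'d) \<times> (real^'r))"
  by (rule linearI) (auto simp: unstack_def vec_eq_iff)

lemma stack_eq_iff [simp]: "stack x = stack y \<longleftrightarrow> x = y"
  by (metis unstack_stack)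

text \<open>The source of all transfer between pairs and stacked vectors: it yields both the inner
  product formula and the preservation of Lebesgue measure.\<close>

lemma bij_betw_stack_Basis:
  "bij_betw (stack :: (real^'d) \<times> (real^'r) \<Rightarrow> _) Basis Basis"
proof -
  have l: "stack (axis i 1 :: real^'d, 0 :: real^'r) = axis (Inl i) 1" for i
    by (auto simp: stack_def vec_eq_iff axis_def split: sum.split)
  have r: "stack (0 :: real^'d, axis j 1 :: real^'r) = axis (Inr j) 1" for j
    by (auto simp: stack_def vec_eq_iff axis_def split: sum.split)
  have "(Basis :: (real^('d + 'r)) set) = (\<lambda>i. axis (Inl i) 1) ` UNIV \<union> (\<lambda>j. axis (Inr j) 1) ` UNIV"
    by (auto simp: Basis_vec_def image_iff) (metis sum.exhaust)
  also have "\<dots> = stack ` (Basis :: ((real^'d) \<times> (real^'r)) set)"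
    by (auto simp: Basis_prod_def Basis_vec_def l[symmetric] r[symmetric] image_iff)
  finally show ?thesis
    by (simp add: bij_betw_def inj_on_def)
qed

lemma inner_stack: "stack x \<bullet> stack y = fst x \<bullet> fst y + snd x \<bullet> snd y"
  by (simp add: bij_betw_Basis_inner[OF linear_stack bij_betw_stack_Basis] inner_prod_def)

lemma measurable_stack [measurable]:
  "(stack :: (real^'d) \<times> (real^'r) \<Rightarrow> _) \<in> borel \<rightarrow>\<^sub>M borel"
  by (intro borel_measurable_continuous_onI linear_continuous_on)
     (use linear_stack linear_conv_bounded_linear in blast)

lemma has_bochner_integral_stack:
  fixes f :: "real^('d::finite + 'r::finite) \<Rightarrow> 'b::{banach, second_countable_topology}"
  assumes f: "has_bochner_integral lborel f v"
  shows "has_bochner_integral lborel (\<lambda>x :: (real^'d) \<times> (real^'r). f (stack x)) v"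
proof -
  have [measurable]: "f \<in> borel_measurable borel"
    using f by (auto dest!: has_bochner_integral_iff[THEN iffD1] borel_measurable_integrable)
  have "distr lborel borel (stack :: (real^'d) \<times> (real^'r) \<Rightarrow> _) = lborel"
    by (rule lborel_distr_bij_Basis[OF linear_stack bij_betw_stack_Basis])
  then have "has_bochner_integral (distr lborel borel (stack :: (real^'d) \<times> (real^'r) \<Rightarrow> _)) f v"
    using f by simp
  then show ?thesis
    by (simp add: has_bochner_integral_iff integrable_distr_eq integral_distr)
qed

lemma hcat_mult_stack: "hcat A B *v stack x = A *v fst x + B *v snd x"
  unfolding vec_eq_iff matrix_vector_mult_def hcat_def
  by (subst UNIV_Plus_UNIV[symmetric], subst sum.Plus) simp_all

section \<open>Gaussian densities on pairs: moments, mode and negative logarithm\<close>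

lemma gaussian_density_pos:
  assumes "spd C"
  shows "0 < gaussian_density \<mu> C x"
  using spd_det_pos[OF assms] by (simp add: gaussian_density_def)

text \<open>At its centre the exponential is 1, so the value there stands for the normalising
  constant.\<close>

lemma neg_ln_gaussian_density:
  assumes "spd C"
  shows "- ln (gaussian_density \<mu> C x) =
    (1/2) * ((x - \<mu>) \<bullet> (matrix_inv C *v (x - \<mu>))) - ln (gaussian_density \<mu> C \<mu>)"
  using spd_det_pos[OF assms] by (simp add: gaussian_density_def ln_div)

context
  fixes C :: "real^('d::finite + 'r::finite)^('d + 'r)" and \<mu> :: "(real^'d) \<times> (real^'r)"
    and f :: "(real^'d) \<times> (real^'r) \<Rightarrow> real"
  assumes C: "spd C"
    and f: "\<And>x. f x = gaussian_density (stack \<mu>) C (stack x)"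
begin

lemma pair_gaussian_total: "has_bochner_integral lborel f 1"
  using has_bochner_integral_stack[OF gaussian_density_total[OF C, of "stack \<mu>"]] by (simp add: f[abs_def])

lemma pair_gaussian_mean: "has_mean f \<mu>"
proof -
  have "bounded_linear (unstack :: _ \<Rightarrow> (real^'d) \<times> (real^'r))"
    using linear_unstack linear_conv_bounded_linear by blast
  from has_bochner_integral_bounded_linear[OF this
      has_bochner_integral_stack[OF gaussian_density_mean[OF C, of "stack \<mu>"]]]
  show ?thesis
    by (simp add: has_mean_def f linear_cmul[OF linear_unstack])
qed

lemma pair_gaussian_mean_iff: "has_mean f x \<longleftrightarrow> x = \<mu>"
  using pair_gaussian_mean by (auto simp: has_mean_def dest: has_bochner_integral_eq)

lemma pair_gaussian_covariance: "has_covariance f C"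
  unfolding has_covariance_def
proof (intro exI conjI allI)
  show "has_mean f \<mu>" by (rule pair_gaussian_mean)
  show "has_bochner_integral lborel
    (\<lambda>x. f x * ((stack x - stack \<mu>) $ k * (stack x - stack \<mu>) $ l)) (C $ k $ l)" for k l
    using has_bochner_integral_stack[OF gaussian_density_covariance[OF C, of "stack \<mu>" k l]] by (simp only: f)
qed

lemma pair_gaussian_pos: "0 < f x"
  by (simp add: f gaussian_density_pos[OF C])

text \<open>The free additive constant absorbs the logarithm of the normalisation. Minimiser,
  convexity and quadratic form are all read off from this description of \<open>J\<close>.\<close>

lemma pair_gaussian_neg_log_density:
  "neg_log_density f J \<longleftrightarrow>
    (\<exists>c. \<forall>x. J x = (1/2) * (stack (x - \<mu>) \<bullet> (matrix_inv C *v stack (x - \<mu>))) + c)"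
proof -
  define c0 where "c0 = ln (gaussian_density (stack \<mu>) C (stack \<mu>))"
  have ln: "- ln (f x) = (1/2) * (stack (x - \<mu>) \<bullet> (matrix_inv C *v stack (x - \<mu>))) - c0" for x
    using neg_ln_gaussian_density[OF C, of "stack \<mu>" "stack x"] by (simp add: f stack_diff c0_def)
  show ?thesis
    unfolding neg_log_density_def ln
  proof (intro iffI; (elim conjE)?; (elim exE)?)
    fix c assume "\<forall>x. J x = (1/2) * (stack (x - \<mu>) \<bullet> (matrix_inv C *v stack (x - \<mu>))) - c0 + c"
    then show "\<exists>c. \<forall>x. J x = (1/2) * (stack (x - \<mu>) \<bullet> (matrix_inv C *v stack (x - \<mu>))) + c"
      by (intro exI[of _ "c - c0"]) simp
  next
    fix c assume "\<forall>x. J x = (1/2) * (stack (x - \<mu>) \<bullet> (matrix_inv C *v stack (x - \<mu>))) + c"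
    then show "(\<forall>x. 0 < f x) \<and> (\<exists>c. \<forall>x. J x = (1/2) * (stack (x - \<mu>) \<bullet> (matrix_inv C *v stack (x - \<mu>))) - c0 + c)"
      by (intro conjI exI[of _ "c + c0"]) (simp_all add: pair_gaussian_pos)
  qed
qed

lemma pair_gaussian_precision_pos:
  "0 \<le> stack x \<bullet> (matrix_inv C *v stack x)"
  "stack x \<bullet> (matrix_inv C *v stack x) = 0 \<longleftrightarrow> x = 0"
proof -
  have "x \<noteq> 0 \<Longrightarrow> 0 < stack x \<bullet> (matrix_inv C *v stack x)"
    using spd_matrix_inv(1)[OF C] stack_eq_iff[of x 0] unfolding spd_def by force
  then show "0 \<le> stack x \<bullet> (matrix_inv C *v stack x)"
    "stack x \<bullet> (matrix_inv C *v stack x) = 0 \<longleftrightarrow> x = 0"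
    by (cases "x = 0"; force)+
qed

lemma pair_gaussian_arg_min:
  assumes "neg_log_density f J"
  shows "is_arg_min J (\<lambda>_. True) x \<longleftrightarrow> x = \<mu>"
proof -
  obtain c where J: "\<And>x. J x = (1/2) * (stack (x - \<mu>) \<bullet> (matrix_inv C *v stack (x - \<mu>))) + c"
    using assms unfolding pair_gaussian_neg_log_density by blast
  have min: "J \<mu> \<le> J x" for x
    using pair_gaussian_precision_pos(1)[of "x - \<mu>"] by (simp add: J)
  have "J x = J \<mu> \<longleftrightarrow> x = \<mu>" for x
    using pair_gaussian_precision_pos(2)[of "x - \<mu>"] by (simp add: J)
  with min show ?thesis
    unfolding is_arg_min_def by (metis not_less order_antisym)
qed

lemma pair_gaussian_neg_ln: "neg_log_density f (\<lambda>x. - ln (f x))"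
  by (simp add: neg_log_density_def pair_gaussian_pos)

text \<open>The logarithm is strictly increasing on positive reals, so maximising \<open>f\<close>
  is minimising its negative logarithm.\<close>

lemma pair_gaussian_arg_max: "is_arg_max f (\<lambda>_. True) x \<longleftrightarrow> x = \<mu>"
  using pair_gaussian_arg_min[OF pair_gaussian_neg_ln, of x] pair_gaussian_pos
  by (simp add: is_arg_min_def is_arg_max_def)

text \<open>For a quadratic the convexity gap is exact: it is half of \<open>t * (1 - t)\<close>
  times the precision form of \<open>x - y\<close>, which is positive for distinct points.\<close>

lemma pair_gaussian_strictly_convex:
  assumes "neg_log_density f J"
  shows "strictly_convex J"
  unfolding strictly_convex_def
proof (intro allI impI, elim conjE)
  fix x y :: "(real^'d) \<times> (real^'r)" and t :: real
  assume xy: "x \<noteq> y" and t: "0 < t" "t < 1"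
  obtain c where J: "\<And>x. J x = (1/2) * (stack (x - \<mu>) \<bullet> (matrix_inv C *v stack (x - \<mu>))) + c"
    using assms unfolding pair_gaussian_neg_log_density by blast
  let ?Q = "matrix_inv C"
  define a b where "a = stack (x - \<mu>)" and "b = stack (y - \<mu>)"
  have "(1 - t) *\<^sub>R x + t *\<^sub>R y - \<mu> = (1 - t) *\<^sub>R (x - \<mu>) + t *\<^sub>R (y - \<mu>)"
    by (simp add: algebra_simps)
  then have s: "stack ((1 - t) *\<^sub>R x + t *\<^sub>R y - \<mu>) = (1 - t) *\<^sub>R a + t *\<^sub>R b"
    by (simp only: a_def b_def stack_add stack_scaleR)
  have comm: "b \<bullet> (?Q *v a) = a \<bullet> (?Q *v b)"
    using spd_inner_commute[OF spd_matrix_inv(1)[OF C]] by (metis inner_commute)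
  have "0 < stack (x - y) \<bullet> (?Q *v stack (x - y))"
    using pair_gaussian_precision_pos[of "x - y"] xy by force
  also have "stack (x - y) = a - b"
    by (simp add: a_def b_def stack_diff)
  finally have "0 < (1/2) * (t * (1 - t)) * ((a - b) \<bullet> (?Q *v (a - b)))"
    using t by simp
  also have "\<dots> = (1 - t) * J x + t * J y - J ((1 - t) *\<^sub>R x + t *\<^sub>R y)"
    unfolding J s a_def[symmetric] b_def[symmetric]
    by (simp add: matrix_vector_mult_diff_distrib matrix_vector_right_distrib matrix_vector_mult_scaleR inner_simps comm)
       (simp add: field_simps)
  finally show "J ((1 - t) *\<^sub>R x + t *\<^sub>R y) < (1 - t) * J x + t * J y"
    by simp
qed

lemma pair_gaussian_quadratic:
  assumes "neg_log_density f J"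
  shows "quadratic J"
proof -
  obtain c where J: "\<And>x. J x = (1/2) * (stack (x - \<mu>) \<bullet> (matrix_inv C *v stack (x - \<mu>))) + c"
    using assms unfolding pair_gaussian_neg_log_density by blast
  let ?Q = "matrix_inv C" and ?m = "stack \<mu>"
  \<comment> \<open>Expanding around the origin: symmetry merges the two mixed terms into one linear
    term.\<close>
  have "J x = (1/2) * (stack x \<bullet> (?Q *v stack x)) + (- (?Q *v ?m)) \<bullet> stack x + ((1/2) * (?m \<bullet> (?Q *v ?m)) + c)" for x
    using spd_inner_commute[OF spd_matrix_inv(1)[OF C], of ?m "stack x"]
    by (simp add: J stack_diff matrix_vector_mult_diff_distrib inner_simps inner_commute[of "stack x" "?Q *v ?m"])
  moreover have "transpose ?Q = ?Q"
    using spd_matrix_inv(1)[OF C] by (simp add: spd_def)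
  ultimately show ?thesis
    unfolding quadratic_def by blast
qed

end

section \<open>The posterior precision, completing the square, and decoupling\<close>

definition posterior_precision :: "real^'d^'m \<Rightarrow> real^'r^'m \<Rightarrow> real^'m^'m \<Rightarrow> real^'d^'d \<Rightarrow> real^('d + 'r)^('d + 'r)" where
  "posterior_precision A R S T = matrix (\<lambda>s. transpose (hcat A R) *v (matrix_inv S *v (hcat A R *v s))
     + stack (matrix_inv T *v fst (unstack s), snd (unstack s)))"

text \<open>The precision is given as the matrix of an operator, with \<open>S\<close> the noise
  covariance and \<open>T\<close> the prior covariance of the first component. The later proofs need
  only its action and its bilinear form, so no block entries have to be written out.\<close>

lemma posterior_precision_mult:
  "posterior_precision A R S T *v s = transpose (hcat A R) *v (matrix_inv S *v (hcat A R *v s))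
     + stack (matrix_inv T *v fst (unstack s), snd (unstack s))"
proof -
  have "linear (\<lambda>s. transpose (hcat A R) *v (matrix_inv S *v (hcat A R *v s))
     + stack (matrix_inv T *v fst (unstack s), snd (unstack s)))"
    by (rule linearI)
       (simp_all add: linear_add[OF linear_unstack] linear_cmul[OF linear_unstack] matrix_vector_right_distrib
          matrix_vector_mult_scaleR scaleR_add_right stack_add[symmetric] stack_scaleR[symmetric] algebra_simps)
  then show ?thesis
    unfolding posterior_precision_def
    by (intro matrix_works) (simp add: linear_def flip: scalar_mult_eq_scaleR)
qed

text \<open>Symmetry, definiteness, the completed square and the vanishing of cross terms are all
  checked on this bilinear form.\<close>

lemma inner_posterior_precision:
  "stack x \<bullet> (posterior_precision A R S T *v stack y) =
     (A *v fst x + R *v snd x) \<bullet> (matrix_inv S *v (A *v fst y + R *v snd y))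
     + fst x \<bullet> (matrix_inv T *v fst y) + snd x \<bullet> snd y"
proof -
  have "stack x \<bullet> (transpose (hcat A R) *v w) = (hcat A R *v stack x) \<bullet> w" for w
    by (metis dot_lmul_matrix transpose_matrix_vector transpose_transpose)
  then show ?thesis
    by (simp add: posterior_precision_mult inner_add_right inner_stack hcat_mult_stack)
qed

lemma spd_nonneg:
  assumes "spd S"
  shows "0 \<le> x \<bullet> (S *v x)"
  using assms by (cases "x = 0") (auto simp: spd_def less_imp_le)

lemma symmetric_matrixI:
  fixes Q :: "real^'n^'n"
  assumes "\<And>x y. x \<bullet> (Q *v y) = y \<bullet> (Q *v x)"
  shows "transpose Q = Q"
proof -
  have "axis i 1 \<bullet> (Q *v axis j 1) = Q $ i $ j" for i j
    by (simp add: inner_axis' matrix_vector_mult_basis column_def)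
  then show ?thesis
    by (metis (no_types, lifting) assms transpose_def vec_eq_iff vec_lambda_beta)
qed

lemma spd_posterior_precision:
  assumes S: "spd S" and T: "spd T"
  shows "spd (posterior_precision A R S T)"
proof -
  let ?Q = "posterior_precision A R S T"
  have comm: "x \<bullet> (matrix_inv V *v y) = y \<bullet> (matrix_inv V *v x)" if "spd V" for V :: "real^'k^'k" and x y
    using spd_inner_commute[OF spd_matrix_inv(1)[OF that]] by (metis inner_commute)
  have "stack x \<bullet> (?Q *v stack y) = stack y \<bullet> (?Q *v stack x)" for x y
    unfolding inner_posterior_precision using comm[OF S] comm[OF T] by (simp add: inner_commute)
  then have "x \<bullet> (?Q *v y) = y \<bullet> (?Q *v x)" for x y
    by (metis stack_unstack)
  then have "transpose ?Q = ?Q"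
    by (rule symmetric_matrixI)
  moreover have "0 < stack x \<bullet> (?Q *v stack x)" if "x \<noteq> 0" for x
  proof -
    have "0 < fst x \<bullet> (matrix_inv T *v fst x) + snd x \<bullet> snd x"
    proof (cases "fst x = 0")
      case True
      then show ?thesis using that by (simp add: prod_eq_iff)
    next
      case False
      then show ?thesis
        using spd_matrix_inv(1)[OF T] by (simp add: spd_def add_pos_nonneg)
    qed
    moreover have "0 \<le> (A *v fst x + R *v snd x) \<bullet> (matrix_inv S *v (A *v fst x + R *v snd x))"
      by (rule spd_nonneg[OF spd_matrix_inv(1)[OF S]])
    ultimately show ?thesis
      unfolding inner_posterior_precision by linarith
  qed
  then have "0 < x \<bullet> (?Q *v x)" if "x \<noteq> 0" for x
    using that by (metis stack_0 stack_unstack)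
  ultimately show ?thesis
    by (simp add: spd_def)
qed

text \<open>The centre \<open>\<mu>\<close> of the completed square solves the normal equations.\<close>

lemma likelihood_prior_eq_gaussian:
  fixes A :: "real^'d^'m" and R :: "real^'r^'m"
  assumes S: "spd S" and T: "spd T"
    and L: "\<And>x. L x = c + A *v fst x + R *v snd x"
  obtains \<mu> k where "0 < k"
    "\<And>x. gaussian_density (L x) S y * (gaussian_density m T (fst x) * gaussian_density 0 (mat 1) (snd x))
       = k * gaussian_density (stack \<mu>) (matrix_inv (posterior_precision A R S T)) (stack x)"
proof -
  let ?Q = "posterior_precision A R S T" and ?P = "matrix_inv S" and ?W = "matrix_inv T"
  let ?C = "matrix_inv ?Q"
  have Q: "spd ?Q" by (rule spd_posterior_precision[OF S T])
  have C: "spd ?C" "matrix_inv ?C = ?Q" by (rule spd_matrix_inv[OF Q])+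
  \<comment> \<open>Right-hand side of the normal equations: back-projected data plus the
    precision-weighted prior mean, whose second component is 0 because that prior is
    centred.\<close>
  define h where "h = transpose (hcat A R) *v (?P *v (y - c)) + stack (?W *v m, 0)"
  define \<mu> where "\<mu> = unstack (?C *v h)"
  have norm: "?Q *v stack \<mu> = h"
    by (simp add: \<mu>_def matrix_vector_mul_assoc spd_invertible(1)[OF Q])
  define r where "r = y - L \<mu>"
  \<comment> \<open>Up to an additive constant, \<open>q\<close> is minus twice the logarithm of
    likelihood times prior.\<close>
  define q where "q x = (y - L x) \<bullet> (?P *v (y - L x)) + (fst x - m) \<bullet> (?W *v (fst x - m)) + snd x \<bullet> snd x" for x
  have q: "q x = q \<mu> + stack (x - \<mu>) \<bullet> (?Q *v stack (x - \<mu>))" for x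
  proof -
    define d where "d = x - \<mu>"
    define Hd where "Hd = A *v fst d + R *v snd d"
    define v where "v = fst \<mu> - m"
    have x: "x = \<mu> + d" by (simp add: d_def)
    have yL: "y - L x = r - Hd"
      by (simp add: r_def Hd_def L x matrix_vector_right_distrib)
    have "stack d \<bullet> h = stack d \<bullet> (?Q *v stack \<mu>)"
      by (simp add: norm)
    moreover have "stack d \<bullet> h = Hd \<bullet> (?P *v (y - c)) + fst d \<bullet> (?W *v m)"
    proof -
      have "stack d \<bullet> (transpose (hcat A R) *v w) = Hd \<bullet> w" for w
        unfolding Hd_def hcat_mult_stack[symmetric]
        by (metis dot_lmul_matrix transpose_matrix_vector transpose_transpose)
      then show ?thesis
        by (simp add: h_def inner_add_right inner_stack)
    qed
    moreover have "stack d \<bullet> (?Q *v stack \<mu>) = Hd \<bullet> (?P *v (y - c - r)) + fst d \<bullet> (?W *v (v + m)) + snd d \<bullet> snd \<mu>"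
      by (simp add: inner_posterior_precision Hd_def r_def v_def L)
    \<comment> \<open>The normal equations tested against \<open>d\<close>. They say that the
      derivative of \<open>q\<close> at \<mu> in direction \<open>d\<close> vanishes, which removes
      the linear term from the expansion below.\<close>
    ultimately have lin: "fst d \<bullet> (?W *v v) + snd d \<bullet> snd \<mu> = Hd \<bullet> (?P *v r)"
      by (simp add: matrix_vector_mult_diff_distrib matrix_vector_right_distrib inner_simps)
    have comm: "r \<bullet> (?P *v Hd) = Hd \<bullet> (?P *v r)" "v \<bullet> (?W *v fst d) = fst d \<bullet> (?W *v v)"
      using spd_inner_commute[OF spd_matrix_inv(1)[OF S]] spd_inner_commute[OF spd_matrix_inv(1)[OF T]]
      by (metis inner_commute)+
    have "q x = (r - Hd) \<bullet> (?P *v (r - Hd)) + (v + fst d) \<bullet> (?W *v (v + fst d)) + (snd \<mu> + snd d) \<bullet> (snd \<mu> + snd d)"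
      by (simp add: q_def yL) (simp add: x v_def algebra_simps)
    also have "\<dots> = (r \<bullet> (?P *v r) + v \<bullet> (?W *v v) + snd \<mu> \<bullet> snd \<mu>)
        + (Hd \<bullet> (?P *v Hd) + fst d \<bullet> (?W *v fst d) + snd d \<bullet> snd d)
        + 2 * (fst d \<bullet> (?W *v v) + snd d \<bullet> snd \<mu> - Hd \<bullet> (?P *v r))"
      by (simp add: matrix_vector_mult_diff_distrib matrix_vector_right_distrib inner_simps comm
          inner_commute[of "snd \<mu>" "snd d"])
    also have "\<dots> = q \<mu> + stack d \<bullet> (?Q *v stack d)"
      using lin by (simp add: q_def r_def v_def inner_posterior_precision Hd_def)
    finally show ?thesis by (simp add: d_def)
  qed
  define n where "n = sqrt ((2 * pi) ^ CARD('m) * det S) * (sqrt ((2 * pi) ^ CARD('d) * det T) *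
    sqrt ((2 * pi) ^ CARD('r) * det (mat 1 :: real^'r^'r)))"
  \<comment> \<open>The minimal value of \<open>q\<close> and the three normalisations in
    \<open>n\<close>, multiplied by the normalisation of the target Gaussian so as to cancel its
    denominator.\<close>
  define k where "k = exp (- (1/2) * q \<mu>) / n * sqrt ((2 * pi) ^ CARD('d + 'r) * det ?C)"
  have pos: "0 < n" "0 < sqrt ((2 * pi) ^ CARD('d + 'r) * det ?C)"
    using spd_det_pos[OF S] spd_det_pos[OF T] spd_det_pos[OF C(1)] by (simp_all add: n_def)
  have "0 < k"
    using pos by (simp add: k_def)
  moreover have "gaussian_density (L x) S y * (gaussian_density m T (fst x) * gaussian_density 0 (mat 1) (snd x))
       = k * gaussian_density (stack \<mu>) ?C (stack x)" for x
  proof -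
    have "matrix_inv (mat 1 :: real^'r^'r) = mat 1"
      by (rule matrix_inv_eqI) simp
    then have "gaussian_density (L x) S y * (gaussian_density m T (fst x) * gaussian_density 0 (mat 1) (snd x))
      = exp (- (1/2) * q x) / n"
      by (simp add: gaussian_density_def q_def n_def exp_add[symmetric] add_divide_distrib algebra_simps)
    also have "\<dots> = exp (- (1/2) * q \<mu>) * exp (- (1/2) * (stack (x - \<mu>) \<bullet> (?Q *v stack (x - \<mu>)))) / n"
      unfolding q[of x] exp_add[symmetric] by (simp add: algebra_simps)
    also have "\<dots> = k * gaussian_density (stack \<mu>) ?C (stack x)"
      using spd_det_pos[OF C(1)] by (simp add: k_def gaussian_density_def C(2) stack_diff)
    finally show ?thesis .
  qed
  ultimately show thesis
    by (rule that)
qed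

text \<open>No block inversion is needed. A column \<open>w\<close> of the covariance with index
  \<open>Inr j\<close> solves \<open>?Q *v stack w = axis (Inr j) 1\<close>. Pairing this with
  \<open>(fst w, 0)\<close> gives 0 on the right; on the left, as the cross term vanishes, it gives
  the precision form of \<open>(fst w, 0)\<close>. Definiteness forces \<open>fst w = 0\<close>. The
  cross-term identity is exported for the factorisation of the density.\<close>

lemma block_diagonal_posterior_covariance:
  fixes A :: "real^'d^'m" and R :: "real^'r^'m"
  assumes S: "spd S" and T: "spd T"
    and dec: "transpose A ** matrix_inv S ** R = 0"
  shows "\<And>u z. (A *v u) \<bullet> (matrix_inv S *v (R *v z)) = 0"
    and "block_diagonal (matrix_inv (posterior_precision A R S T))"
proof -
  let ?Q = "posterior_precision A R S T"
  have Q: "spd ?Q" by (rule spd_posterior_precision[OF S T])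
  show cross: "(A *v u) \<bullet> (matrix_inv S *v (R *v z)) = 0" for u z
  proof -
    have "(A *v u) \<bullet> (matrix_inv S *v (R *v z)) = u \<bullet> ((transpose A ** matrix_inv S ** R) *v z)"
      by (metis dot_lmul_matrix matrix_vector_mul_assoc transpose_matrix_vector transpose_transpose)
    then show ?thesis by (simp add: dec)
  qed
  let ?C = "matrix_inv ?Q"
  have C: "spd ?C" by (rule spd_matrix_inv[OF Q])
  have "?C $ Inl i $ Inr j = 0" for i j
  proof -
    define w where "w = unstack (?C *v axis (Inr j) 1)"
    have w: "?Q *v stack w = axis (Inr j) 1"
      by (simp add: w_def matrix_vector_mul_assoc spd_invertible(1)[OF Q])
    let ?a = "(fst w, 0 :: real^'r)"
    have "0 = stack ?a \<bullet> (?Q *v stack w)"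
      by (simp add: w inner_axis)
    also have "\<dots> = stack ?a \<bullet> (?Q *v stack ?a)"
      by (simp add: inner_posterior_precision matrix_vector_right_distrib inner_add_right cross)
    finally have "stack ?a = stack 0"
      using Q unfolding spd_def by force
    then have "fst w = 0"
      unfolding stack_eq_iff by (simp add: zero_prod_def)
    moreover have "fst w $ i = ?C $ Inl i $ Inr j"
      by (simp add: w_def unstack_def matrix_vector_mult_basis column_def)
    ultimately show ?thesis by simp
  qed
  moreover have "?C $ Inr j $ Inl i = ?C $ Inl i $ Inr j" for i j
  proof -
    have "transpose ?C = ?C"
      using C by (simp add: spd_def)
    then have "transpose ?C $ Inl i $ Inr j = ?C $ Inl i $ Inr j"
      by simp
    then show ?thesis
      by (simp add: transpose_def)
  qed
  ultimately show "block_diagonal ?C"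
    by (simp add: block_diagonal_def)
qed

text \<open>The factors \<open>a\<close> and \<open>b\<close> may be unnormalised: total mass 1
  forces the product of their integrals to be 1, and exactly this product appears when the two
  marginals are multiplied.\<close>

lemma product_density_factorizes:
  fixes f :: "'a::euclidean_space \<times> 'b::euclidean_space \<Rightarrow> real"
  assumes f: "has_bochner_integral lborel f 1"
    and prod: "\<And>u z. f (u, z) = a u * b z"
  shows "f (u, z) = (\<integral>z'. f (u, z') \<partial>lborel) * (\<integral>u'. f (u', z) \<partial>lborel)"
proof -
  have "1 = (\<integral>x. f x \<partial>(lborel \<Otimes>\<^sub>M lborel))"
    using f by (simp add: lborel_prod has_bochner_integral_iff)
  also have "\<dots> = (\<integral>u. \<integral>z. f (u, z) \<partial>lborel \<partial>lborel)"
    using f by (intro lborel_pair.integral_fst'[symmetric]) (simp add: lborel_prod has_bochner_integral_iff)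
  also have "\<dots> = (\<integral>u. a u \<partial>lborel) * (\<integral>z. b z \<partial>lborel)"
    by (simp add: prod)
  finally show ?thesis
    by (simp add: prod mult_ac)
qed

subsection \<open>The joint law and Bayes' rule\<close>

text \<open>Independence fixes the joint law on rectangles, which determine it as the product
  measure. Used for the two prior components, and again for the noise against their pair.\<close>

lemma distributed_pair_independent_rvs:
  fixes X :: "'w \<Rightarrow> 'a::euclidean_space" and Y :: "'w \<Rightarrow> 'b::euclidean_space"
  assumes "prob_space M"
    and X: "distributed M lborel X f" and Y: "distributed M lborel Y g"
    and ind: "independent_rvs M X Y"
  shows "distributed M (lborel \<Otimes>\<^sub>M lborel) (\<lambda>\<omega>. (X \<omega>, Y \<omega>)) (\<lambda>(x, y). f x * g y)"
proof -
  interpret prob_space M by fact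
  have [measurable]: "X \<in> borel_measurable M" "Y \<in> borel_measurable M"
    using ind by (simp_all add: independent_rvs_def)
  interpret DX: prob_space "distr M lborel X" by (rule prob_space_distr) measurable
  interpret DY: prob_space "distr M lborel Y" by (rule prob_space_distr) measurable
  have "distr M lborel X \<Otimes>\<^sub>M distr M lborel Y = distr M (lborel \<Otimes>\<^sub>M lborel) (\<lambda>\<omega>. (X \<omega>, Y \<omega>))"
  proof (rule pair_measure_eqI)
    fix A B assume "A \<in> sets (distr M lborel X)" "B \<in> sets (distr M lborel Y)"
    then have [measurable]: "A \<in> sets borel" "B \<in> sets borel" by simp_all
    have "prob ((X -` A \<inter> space M) \<inter> (Y -` B \<inter> space M)) = prob (X -` A \<inter> space M) * prob (Y -` B \<inter> space M)"
      using ind unfolding independent_rvs_def by (intro indep_setD) auto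
    moreover have "(\<lambda>\<omega>. (X \<omega>, Y \<omega>)) -` (A \<times> B) \<inter> space M = (X -` A \<inter> space M) \<inter> (Y -` B \<inter> space M)"
      by auto
    ultimately show "emeasure (distr M lborel X) A * emeasure (distr M lborel Y) B
      = emeasure (distr M (lborel \<Otimes>\<^sub>M lborel) (\<lambda>\<omega>. (X \<omega>, Y \<omega>))) (A \<times> B)"
      by (simp add: emeasure_distr emeasure_eq_measure ennreal_mult)
  qed (simp_all add: DX.sigma_finite_measure_axioms DY.sigma_finite_measure_axioms)
  then show ?thesis
    by (rule distributed_joint_indep'[OF sigma_finite_lborel sigma_finite_lborel X Y])
qed

lemma nn_integral_lborel_translate:
  fixes f :: "'a::euclidean_space \<Rightarrow> ennreal"
  assumes [measurable]: "f \<in> borel_measurable borel"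
  shows "(\<integral>\<^sup>+x. f (c + x) \<partial>lborel) = (\<integral>\<^sup>+x. f x \<partial>lborel)"
proof -
  have "(\<integral>\<^sup>+x. f (c + x) \<partial>lborel) = (\<integral>\<^sup>+x. f x \<partial>distr lborel borel ((+) c))"
    by (subst nn_integral_distr) simp_all
  then show ?thesis
    by (simp only: lborel_distr_plus)
qed

text \<open>The map from \<open>(e, x)\<close> to \<open>(x, L x + e)\<close> is, for each fixed
  \<open>x\<close>, a translation in \<open>e\<close>. Hence it preserves Lebesgue measure whatever
  the measurable \<open>L\<close> is, and the density is merely rewritten in the new
  variables.\<close>

lemma distributed_additive_noise:
  fixes X :: "'w \<Rightarrow> 'a::euclidean_space" and E :: "'w \<Rightarrow> 'b::euclidean_space"
  assumes EX: "distributed M (lborel \<Otimes>\<^sub>M lborel) (\<lambda>\<omega>. (E \<omega>, X \<omega>)) (\<lambda>(e, x). f e * g x)"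
    and [measurable]: "f \<in> borel_measurable borel" "g \<in> borel_measurable borel" "L \<in> borel \<rightarrow>\<^sub>M borel"
  shows "distributed M (lborel \<Otimes>\<^sub>M lborel) (\<lambda>\<omega>. (X \<omega>, L (X \<omega>) + E \<omega>)) (\<lambda>(x, y). f (y - L x) * g x)"
  unfolding distributed_def
proof (intro conjI)
  let ?B = "lborel \<Otimes>\<^sub>M lborel"
  have EXm: "(\<lambda>\<omega>. (E \<omega>, X \<omega>)) \<in> M \<rightarrow>\<^sub>M lborel \<Otimes>\<^sub>M lborel"
    using EX by (rule distributed_measurable)
  have [measurable]: "E \<in> borel_measurable M" "X \<in> borel_measurable M"
    using measurable_compose[OF EXm measurable_fst] measurable_compose[OF EXm measurable_snd] by simp_all
  show XY: "(\<lambda>\<omega>. (X \<omega>, L (X \<omega>) + E \<omega>)) \<in> M \<rightarrow>\<^sub>M lborel \<Otimes>\<^sub>M lborel"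
    by measurable
  show "(\<lambda>(x, y). f (y - L x) * g x) \<in> borel_measurable (lborel \<Otimes>\<^sub>M lborel)"
    by measurable
  show "distr M ?B (\<lambda>\<omega>. (X \<omega>, L (X \<omega>) + E \<omega>)) = density ?B (\<lambda>(x, y). f (y - L x) * g x)"
  proof (rule measure_eqI)
    fix A assume "A \<in> sets (distr M ?B (\<lambda>\<omega>. (X \<omega>, L (X \<omega>) + E \<omega>)))"
    then have [measurable]: "A \<in> sets ?B"
      by simp
    then have [measurable]: "A \<in> sets (borel \<Otimes>\<^sub>M borel)"
      by (simp cong: sets_pair_measure_cong)
    define T where "T = (\<lambda>(e, x). (x, L x + e))"
    have T [measurable]: "T \<in> ?B \<rightarrow>\<^sub>M ?B"
      unfolding T_def by measurable
    have "emeasure (distr M ?B (\<lambda>\<omega>. (X \<omega>, L (X \<omega>) + E \<omega>))) A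
      = (\<integral>\<^sup>+\<omega>. indicator A (X \<omega>, L (X \<omega>) + E \<omega>) \<partial>M)"
      by (subst nn_integral_distr[symmetric, OF XY]) simp_all
    also have "\<dots> = (\<integral>\<^sup>+p. indicator A (T p) \<partial>distr M ?B (\<lambda>\<omega>. (E \<omega>, X \<omega>)))"
      by (subst nn_integral_distr[OF EXm]) (simp_all add: T_def)
    also have "\<dots> = (\<integral>\<^sup>+p. (case p of (e, x) \<Rightarrow> f e * g x) * indicator A (T p) \<partial>?B)"
      unfolding distributed_distr_eq_density[OF EX] by (subst nn_integral_density) simp_all
    also have "\<dots> = (\<integral>\<^sup>+x. \<integral>\<^sup>+e. f e * g x * indicator A (x, L x + e) \<partial>lborel \<partial>lborel)"
      by (subst lborel_pair.nn_integral_snd[symmetric]) (simp_all add: T_def)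
    also have "\<dots> = (\<integral>\<^sup>+x. \<integral>\<^sup>+y. f (y - L x) * g x * indicator A (x, y) \<partial>lborel \<partial>lborel)"
    proof (rule nn_integral_cong)
      fix x
      show "(\<integral>\<^sup>+e. f e * g x * indicator A (x, L x + e) \<partial>lborel)
        = (\<integral>\<^sup>+y. f (y - L x) * g x * indicator A (x, y) \<partial>lborel)"
        using nn_integral_lborel_translate[of "\<lambda>y. f (y - L x) * g x * indicator A (x, y)" "L x"] by simp
    qed
    also have "\<dots> = (\<integral>\<^sup>+p. (case p of (x, y) \<Rightarrow> f (y - L x) * g x) * indicator A p \<partial>?B)"
      by (subst lborel.nn_integral_fst[symmetric]) simp_all
    also have "\<dots> = emeasure (density ?B (\<lambda>(x, y). f (y - L x) * g x)) A"
      by (subst emeasure_density) simp_all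
    finally show "emeasure (distr M ?B (\<lambda>\<omega>. (X \<omega>, L (X \<omega>) + E \<omega>))) A
      = emeasure (density ?B (\<lambda>(x, y). f (y - L x) * g x)) A" .
  qed simp
qed

text \<open>The integral \<open>Z y\<close> is at once the normalising constant of Bayes' formula
  and the marginal density of \<open>Y\<close> at \<open>y\<close>, so multiplying the posterior by
  it restores the joint density.\<close>

lemma conditional_density_bayes_posterior:
  fixes X :: "'w \<Rightarrow> 'a::euclidean_space" and Y :: "'w \<Rightarrow> 'b::euclidean_space"
  assumes "prob_space M"
    and XY: "distributed M (lborel \<Otimes>\<^sub>M lborel) (\<lambda>\<omega>. (X \<omega>, Y \<omega>)) (\<lambda>(x, y). ennreal (lik y x * prior x))"
    and nonneg: "\<And>x y. 0 \<le> lik y x * prior x"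
    and evidence: "\<And>y. has_bochner_integral lborel (\<lambda>x. lik y x * prior x) (Z y)" "\<And>y. 0 < Z y"
  shows "conditional_density M X Y (bayes_posterior lik prior)"
proof -
  interpret prob_space M by fact
  have post: "bayes_posterior lik prior y x = lik y x * prior x / Z y" for y x
    using evidence(1)[of y] by (simp add: bayes_posterior_def has_bochner_integral_iff)
  have Y: "distributed M lborel Y (\<lambda>y. ennreal (Z y))"
  proof -
    have "(\<integral>\<^sup>+x. ennreal (lik y x * prior x) \<partial>lborel) = ennreal (Z y)" for y
      using evidence(1)[of y] nonneg by (simp add: nn_integral_eq_integral has_bochner_integral_iff)
    then show ?thesis
      using distr_marginal2[OF sigma_finite_lborel sigma_finite_lborel XY] by simp
  qed
  show ?thesis
    unfolding conditional_density_def
  proof (intro conjI allI exI)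
    show "0 \<le> bayes_posterior lik prior y x" for y x
      using nonneg[of y x] evidence(2)[of y] by (simp add: post)
    show "has_bochner_integral lborel (bayes_posterior lik prior y) 1" for y
      using has_bochner_integral_divide_zero[OF evidence(1)[of y], of "Z y"] evidence(2)[of y]
      by (simp add: post[abs_def])
    show "distributed M lborel Y (\<lambda>y. ennreal (Z y))" by (rule Y)
    have "ennreal (Z y) * ennreal (bayes_posterior lik prior y x) = ennreal (lik y x * prior x)" for x y
      using nonneg[of y x] evidence(2)[of y] by (subst ennreal_mult[symmetric]) (simp_all add: post)
    then show "distributed M lborel (\<lambda>\<omega>. (X \<omega>, Y \<omega>)) (\<lambda>(x, y). ennreal (Z y) * ennreal (bayes_posterior lik prior y x))"
      using XY by (simp add: lborel_prod)
  qed
qed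

lemma borel_measurable_gaussian_density [measurable]: "gaussian_density \<mu> C \<in> borel_measurable borel"
  unfolding gaussian_density_def by measurable

section \<open>Posterior, decoupling and injectivity for the linearised model\<close>

theorem proposition4p5:
  fixes G :: "(real^'d) \<times> (real^'r) \<Rightarrow> real^'p"
    and F :: "real^'p \<Rightarrow> real^'m"
    and H :: "(real^'d) \<times> (real^'r) \<Rightarrow> real^'m"
    and u0 m_u :: "real^'d" and z0 :: "real^'r"
    and A_u :: "real^'d^'m" and A_rec :: "real^'r^'m"
    and L :: "(real^'d) \<times> (real^'r) \<Rightarrow> real^'m"
    and S_eps :: "real^'m^'m" and S_u :: "real^'d^'d"
    and M :: "'w measure"
    and U :: "'w \<Rightarrow> real^'d" and Z :: "'w \<Rightarrow> real^'r" and E Y :: "'w \<Rightarrow> real^'m"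
    and post :: "real^'m \<Rightarrow> (real^'d) \<times> (real^'r) \<Rightarrow> real"
  assumes H_def: "H = F \<circ> G"
    and H_C1: "continuously_differentiable_at H (u0, z0)"
    and A_u_def: "A_u = jacobian (\<lambda>u. H (u, z0)) (at u0)"
    and A_rec_def: "A_rec = jacobian (\<lambda>z. H (u0, z)) (at z0)"
    and L_def: "L = (\<lambda>(u, z). H (u0, z0) + A_u *v (u - u0) + A_rec *v (z - z0))"
    and spd_eps: "spd S_eps"
    and spd_u: "spd S_u"
    and prob: "prob_space M"
    and U_dist: "distributed M lborel U (\<lambda>u. ennreal (gaussian_density m_u S_u u))"
    and Z_dist: "distributed M lborel Z (\<lambda>z. ennreal (gaussian_density 0 (mat 1) z))"
    and E_dist: "distributed M lborel E (\<lambda>e. ennreal (gaussian_density 0 S_eps e))"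
    and UZ_indep: "independent_rvs M U Z"
    and E_indep: "independent_rvs M E (\<lambda>\<omega>. (U \<omega>, Z \<omega>))"
    and Y_def: "Y = (\<lambda>\<omega>. L (U \<omega>, Z \<omega>) + E \<omega>)"
    and post_def: "post = bayes_posterior
          (\<lambda>y x. gaussian_density (L x) S_eps y)
          (\<lambda>(u, z). gaussian_density m_u S_u u * gaussian_density 0 (mat 1) z)"
  shows
    "conditional_density M (\<lambda>\<omega>. (U \<omega>, Z \<omega>)) Y post
     \<and> (\<forall>y.
          (\<exists>J. neg_log_density (post y) J) \<and>
          (\<forall>J. neg_log_density (post y) J \<longrightarrow>
             strictly_convex J \<and> quadratic J \<and> (\<exists>!x. is_arg_min J (\<lambda>_. True) x)) \<and>
          (\<exists>\<mu> C. spd C \<and> (\<forall>x. post y x = gaussian_density (stack \<mu>) C (stack x)) \<and>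
             has_covariance (post y) C \<and>
             (\<forall>x. has_mean (post y) x \<longleftrightarrow> x = \<mu>) \<and>
             (\<forall>x. is_arg_max (post y) (\<lambda>_. True) x \<longleftrightarrow> x = \<mu>) \<and>
             (\<forall>J x. neg_log_density (post y) J \<longrightarrow>
                (is_arg_min J (\<lambda>_. True) x \<longleftrightarrow> x = \<mu>))))
     \<and> (transpose A_u ** matrix_inv S_eps ** A_rec = 0 \<longrightarrow>
          (\<forall>y.
             (\<forall>u z. post y (u, z) =
                (\<integral>z'. post y (u, z') \<partial>lborel) * (\<integral>u'. post y (u', z) \<partial>lborel)) \<and>
             (\<exists>C. has_covariance (post y) C \<and> block_diagonal C)))
     \<and> (rank (hcat A_u A_rec) = CARD('d) + CARD('r) \<longrightarrow>
          inj L \<and> (\<forall>y\<in>range L. \<exists>!x. y = L x))"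
proof -
  let ?lik = "\<lambda>y x. gaussian_density (L x) S_eps y"
  let ?prior = "\<lambda>(u, z :: real^'r). gaussian_density m_u S_u u * gaussian_density 0 (mat 1) z"
  let ?Q = "posterior_precision A_u A_rec S_eps S_u"
  let ?C = "matrix_inv ?Q"
  \<comment> \<open>Collects the reference point into one offset, so that \<open>L\<close> is affine
    in the pair itself.\<close>
  define c where "c = H (u0, z0) - A_u *v u0 - A_rec *v z0"
  have L: "L x = c + A_u *v fst x + A_rec *v snd x" for x
    by (simp add: L_def c_def split_beta matrix_vector_mult_diff_distrib)
  have prior: "?prior x = gaussian_density m_u S_u (fst x) * gaussian_density 0 (mat 1) (snd x)" for x
    by (simp add: split_beta)
  have Q: "spd ?Q" by (rule spd_posterior_precision[OF spd_eps spd_u])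
  have C: "spd ?C" "matrix_inv ?C = ?Q" by (rule spd_matrix_inv[OF Q])+
  have "\<exists>\<mu> k. 0 < k \<and> (\<forall>x. ?lik y x * ?prior x = k * gaussian_density (stack \<mu>) ?C (stack x))" for y
    unfolding prior using likelihood_prior_eq_gaussian[OF spd_eps spd_u L, of y m_u] by metis
  \<comment> \<open>Only the centre and the constant vary with \<open>y\<close>; the covariance
    \<open>?C\<close> is the same for all data.\<close>
  then obtain \<mu> k where k: "\<And>y. 0 < k y"
    and lp: "\<And>y x. ?lik y x * ?prior x = k y * gaussian_density (stack (\<mu> y)) ?C (stack x)"
    by metis
  \<comment> \<open>The Gaussian on the right of \<open>lp\<close> has total mass 1, which
    identifies \<open>k y\<close> as the evidence.\<close>
  have evidence: "has_bochner_integral lborel (\<lambda>x. ?lik y x * ?prior x) (k y)" for y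
    unfolding lp
    using has_bochner_integral_mult_right[OF has_bochner_integral_stack[OF gaussian_density_total[OF C(1)]], of "k y"]
    by simp
  have post: "post y x = gaussian_density (stack (\<mu> y)) ?C (stack x)" for y x
  proof -
    have "post y x = ?lik y x * ?prior x / k y"
      using evidence[of y] by (simp only: post_def bayes_posterior_def has_bochner_integral_iff)
    then show ?thesis
      using k[of y] by (simp only: lp) simp
  qed

  have cond: "conditional_density M (\<lambda>\<omega>. (U \<omega>, Z \<omega>)) Y post"
    unfolding post_def
  proof (rule conditional_density_bayes_posterior[OF prob _ _ evidence k])
    have UZ: "distributed M lborel (\<lambda>\<omega>. (U \<omega>, Z \<omega>)) (\<lambda>x. ennreal (?prior x))"
      using distributed_pair_independent_rvs[OF prob U_dist Z_dist UZ_indep]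
      by (simp add: lborel_prod case_prod_unfold ennreal_mult gaussian_density_pos[OF spd_u] gaussian_density_pos[OF spd_mat_1] less_imp_le)
    have Lm: "L \<in> borel \<rightarrow>\<^sub>M borel"
      unfolding L[abs_def]
      by (intro borel_measurable_add borel_measurable_const borel_measurable_matrix_vector_mult
          borel_measurable_continuous_onI continuous_intros)
    have pm: "(\<lambda>x. ennreal (?prior x)) \<in> borel_measurable borel"
      using distributed_borel_measurable[OF UZ] by simp
    have "distributed M (lborel \<Otimes>\<^sub>M lborel) (\<lambda>\<omega>. ((U \<omega>, Z \<omega>), L (U \<omega>, Z \<omega>) + E \<omega>))
      (\<lambda>(x, y). ennreal (gaussian_density 0 S_eps (y - L x)) * ennreal (?prior x))"
      by (rule distributed_additive_noise[OF distributed_pair_independent_rvs[OF prob E_dist UZ E_indep] _ pm Lm])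
         measurable
    \<comment> \<open>The noise density at the residual is the likelihood: a Gaussian density
      depends on its argument and mean only through their difference.\<close>
    moreover have "gaussian_density 0 S_eps (y - L x) = gaussian_density (L x) S_eps y" for x y
      by (simp add: gaussian_density_def)
    ultimately show "distributed M (lborel \<Otimes>\<^sub>M lborel) (\<lambda>\<omega>. ((U \<omega>, Z \<omega>), Y \<omega>))
      (\<lambda>(x, y). ennreal (?lik y x * ?prior x))"
      using gaussian_density_pos[OF spd_eps] by (simp add: Y_def ennreal_mult' less_imp_le)
    show "0 \<le> ?lik y x * ?prior x" for x y
      by (simp add: prior gaussian_density_pos[OF spd_eps] gaussian_density_pos[OF spd_u]
          gaussian_density_pos[OF spd_mat_1] less_imp_le)
  qed

  have unique: "\<exists>!x. is_arg_min J (\<lambda>_. True) x" if "neg_log_density (post y) J" for y J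
    by (simp add: pair_gaussian_arg_min[OF C(1) post that])

  have decoupled: "(\<forall>u z. post y (u, z) =
        (\<integral>z'. post y (u, z') \<partial>lborel) * (\<integral>u'. post y (u', z) \<partial>lborel)) \<and>
      (\<exists>C. has_covariance (post y) C \<and> block_diagonal C)"
    if dec: "transpose A_u ** matrix_inv S_eps ** A_rec = 0" for y
  proof (intro conjI allI exI)
    note block = block_diagonal_posterior_covariance[OF spd_eps spd_u dec]
    show "has_covariance (post y) ?C"
      by (rule pair_gaussian_covariance[OF C(1) post])
    show "block_diagonal ?C" by (rule block(2))
    define K where "K = gaussian_density (stack (\<mu> y)) ?C (stack (\<mu> y))"
    \<comment> \<open>\<open>a\<close> and \<open>b\<close> carry the two diagonal blocks of the
      centred precision form; the constant \<open>K\<close> is later attached to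
      \<open>a\<close>.\<close>
    define a where "a u = exp (- (1/2) * (stack (u - fst (\<mu> y), 0 :: real^'r) \<bullet> (?Q *v stack (u - fst (\<mu> y), 0))))" for u
    define b where "b z = exp (- (1/2) * (stack (0 :: real^'d, z - snd (\<mu> y)) \<bullet> (?Q *v stack (0, z - snd (\<mu> y)))))" for z
    have cross': "(A_rec *v z) \<bullet> (matrix_inv S_eps *v (A_u *v u)) = 0" for u z
      using block(1)[of u z] spd_inner_commute[OF spd_matrix_inv(1)[OF spd_eps]] by (metis inner_commute)
    have "stack (x - \<mu> y) \<bullet> (?Q *v stack (x - \<mu> y)) =
        stack (fst x - fst (\<mu> y), 0) \<bullet> (?Q *v stack (fst x - fst (\<mu> y), 0)) +
        stack (0, snd x - snd (\<mu> y)) \<bullet> (?Q *v stack (0, snd x - snd (\<mu> y)))" for x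
      by (simp add: inner_posterior_precision matrix_vector_right_distrib inner_add_left inner_add_right block(1) cross')
    then have "post y x = K * a (fst x) * b (snd x)" for x
      by (simp add: post K_def a_def b_def gaussian_density_def C(2) stack_diff[symmetric] exp_add[symmetric]
          add_divide_distrib)
    then have "post y (u, z) = (K * a u) * b z" for u z
      by simp
    then show "post y (u, z) = (\<integral>z'. post y (u, z') \<partial>lborel) * (\<integral>u'. post y (u', z) \<partial>lborel)" for u z
      by (rule product_density_factorizes[OF pair_gaussian_total[OF C(1) post]])
  qed

  have inj: "inj L" if "rank (hcat A_u A_rec) = CARD('d) + CARD('r)"
  proof (rule injI)
    fix x x' assume "L x = L x'"
    then have "hcat A_u A_rec *v stack x = hcat A_u A_rec *v stack x'"
      by (simp add: L hcat_mult_stack add.assoc)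
    \<comment> \<open>\<open>CARD('d) + CARD('r)\<close> is the number of columns, so this rank is
      full column rank; the offset \<open>c\<close> has already cancelled.\<close>
    moreover have "inj ((*v) (hcat A_u A_rec))"
      using that full_rank_injective[of "hcat A_u A_rec"] by simp
    ultimately show "x = x'"
      by (metis injD stack_eq_iff)
  qed

  show ?thesis
  proof (intro conjI allI impI)
    show "conditional_density M (\<lambda>\<omega>. (U \<omega>, Z \<omega>)) Y post" by (rule cond)
  next
    fix y
    show "\<exists>J. neg_log_density (post y) J"
      using pair_gaussian_neg_ln[OF C(1) post] by blast
    show "strictly_convex J" "quadratic J" "\<exists>!x. is_arg_min J (\<lambda>_. True) x" if "neg_log_density (post y) J" for J
      by (rule pair_gaussian_strictly_convex[OF C(1) post that] pair_gaussian_quadratic[OF C(1) post that] unique[OF that])+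
    show "\<exists>\<mu> C. spd C \<and> (\<forall>x. post y x = gaussian_density (stack \<mu>) C (stack x)) \<and>
             has_covariance (post y) C \<and>
             (\<forall>x. has_mean (post y) x \<longleftrightarrow> x = \<mu>) \<and>
             (\<forall>x. is_arg_max (post y) (\<lambda>_. True) x \<longleftrightarrow> x = \<mu>) \<and>
             (\<forall>J x. neg_log_density (post y) J \<longrightarrow>
                (is_arg_min J (\<lambda>_. True) x \<longleftrightarrow> x = \<mu>))"
      by (intro exI[of _ "\<mu> y"] exI[of _ ?C] conjI allI impI C(1) post pair_gaussian_covariance[OF C(1) post]
          pair_gaussian_mean_iff[OF C(1) post] pair_gaussian_arg_max[OF C(1) post] pair_gaussian_arg_min[OF C(1) post])
  next
    fix y u z
    assume dec: "transpose A_u ** matrix_inv S_eps ** A_rec = 0"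
    show "post y (u, z) = (\<integral>z'. post y (u, z') \<partial>lborel) * (\<integral>u'. post y (u', z) \<partial>lborel)"
      using decoupled[OF dec] by blast
    show "\<exists>C. has_covariance (post y) C \<and> block_diagonal C"
      using decoupled[OF dec] by blast
  next
    assume r: "rank (hcat A_u A_rec) = CARD('d) + CARD('r)"
    show "inj L" by (rule inj[OF r])
    show "\<forall>y\<in>range L. \<exists>!x. y = L x"
      using inj[OF r] by (auto dest: injD)
  qed
qed

end
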